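(* Let $\alpha_{\min}\le\alpha_{\max}$ and $\beta_{\min}\le\beta_{\max}$ be finite real numbers and let $(\alpha_0,\beta_0)\in[\alpha_{\min},\alpha_{\max}]\times[\beta_{\min},\beta_{\max}]$ be the (fixed) true parameter. For each number of vertices $n_V$, let $(\hat\alpha^{\ddagger},\hat\beta^{\ddagger})$ denote the maximum likelihood estimator of $(\alpha_0,\beta_0)$ based on a single network $Y\sim p^{\ddagger}_{\alpha_0,\beta_0}$ (using the likelihood $(\alpha,\beta)\mapsto p^{\ddagger}_{\alpha,\beta}(Y)$). Then, as $n_V\to\infty$, $(\hat\alpha^{\ddagger},\hat\beta^{\ddagger})$ is $n_V^{1/2}$-consistent for $(\alpha_0,\beta_0)$, and $$\sqrt{n_V}\begin{pmatrix}\hat\alpha^{\ddagger}-\alpha_0\\ \hat\beta^{\ddagger}-\beta_0\end{pmatrix}\;\longrightarrow\; N\left(0,\; e^{-\alpha_0}\begin{bmatrix}1&-2\\-2&4+2e^{-\alpha_0-\beta_0}\end{bmatrix}\right)\quad\text{in distribution}.$$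
   Context: A directed network (no self-loops) on the vertex set $\{1,\dots,n_V\}$ is represented by its adjacency matrix $Y=(Y_{ij})\in\{0,1\}^{n_V\times n_V}$ with $Y_{ii}=0$ for all $i$; $Y_{ij}=1$ means there is a tie $(i,j)$. The Bernoulli model with reciprocity $p_{\alpha,\beta}$, $(\alpha,\beta)\in\mathbb{R}^2$, is the probability distribution on such matrices given by $$p_{\alpha,\beta}(Y=y)=\prod_{i<j}\frac{\exp\{\alpha(y_{ij}+y_{ji})+\beta y_{ij}y_{ji}\}}{1+2e^{\alpha}+e^{2\alpha+\beta}}.$$ The sparse model $p^{\ddagger}_{\alpha,\beta}$ is the same model with $\alpha$ replaced by $\alpha-\log n_V$ and $\beta$ replaced by $\beta+\log n_V$: $$p^{\ddagger}_{\alpha,\beta}(Y=y)=p_{\alpha-\log n_V,\;\beta+\log n_V}(Y=y)=\prod_{i<j}\frac{\exp\{(\alpha-\log n_V)(y_{ij}+y_{ji})+(\beta+\log n_V)y_{ij}y_{ji}\}}{1+2e^{\alpha}/n_V+e^{2\alpha+\beta}/n_V}.$$ A maximum likelihood estimator is a maximizer over $(\alpha,\beta)\in\mathbb{R}^2$ of the likelihood of the observed network; on the event that no maximizer exists it may be assigned an arbitrary value. An estimator $\hat\theta$ is $r_n$-consistent for $\theta_0$ if $r_n(\hat\theta-\theta_0)=O_P(1)$ as $n_V\to\infty$. $N(\mu,\Sigma)$ denotes the (bivariate) normal distribution with mean $\mu$ and covariance matrix $\Sigma$. *)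

theory Defs
  imports "HOL-Probability.Probability"
begin

text \<open>
  A network is given by its adjacency matrix. Entries outside \<open>{1..n} \<times> {1..n}\<close> are set to 0,
  so that a matrix over \<open>{1..n}\<close> corresponds to exactly one function.
\<close>

type_synonym network = "nat \<Rightarrow> nat \<Rightarrow> nat"

definition networks :: "nat \<Rightarrow> network set" where
  "networks n =
    {y. \<forall>i j. y i j \<in> {0, 1} \<and> (y i j = 1 \<longrightarrow> i \<in> {1..n} \<and> j \<in> {1..n} \<and> i \<noteq> j)}"

definition dyads :: "nat \<Rightarrow> (nat \<times> nat) set" where
  "dyads n = {(i, j). i \<in> {1..n} \<and> j \<in> {1..n} \<and> i < j}"

definition bernoulli_mass :: "nat \<Rightarrow> real \<Rightarrow> real \<Rightarrow> network \<Rightarrow> real" where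
  "bernoulli_mass n \<alpha> \<beta> y =
    (\<Prod>(i, j)\<in>dyads n.
       exp (\<alpha> * (real (y i j) + real (y j i)) + \<beta> * real (y i j) * real (y j i)) /
       (1 + 2 * exp \<alpha> + exp (2 * \<alpha> + \<beta>)))"

definition sparse_mass :: "nat \<Rightarrow> real \<Rightarrow> real \<Rightarrow> network \<Rightarrow> real" where
  "sparse_mass n \<alpha> \<beta> = bernoulli_mass n (\<alpha> - ln (real n)) (\<beta> + ln (real n))"

lemma sparse_mass_eq:
  assumes "n \<ge> 1"
  shows "sparse_mass n \<alpha> \<beta> y =
    (\<Prod>(i, j)\<in>dyads n.
       exp ((\<alpha> - ln (real n)) * (real (y i j) + real (y j i)) +
            (\<beta> + ln (real n)) * real (y i j) * real (y j i)) /
       (1 + 2 * exp \<alpha> / real n + exp (2 * \<alpha> + \<beta>) / real n))"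
proof -
  have 1: "exp (\<alpha> - ln (real n)) = exp \<alpha> / real n"
    using assms by (simp add: exp_diff)
  have "2 * (\<alpha> - ln (real n)) + (\<beta> + ln (real n)) = 2 * \<alpha> + \<beta> - ln (real n)"
    by simp
  then have 2: "exp (2 * (\<alpha> - ln (real n)) + (\<beta> + ln (real n))) = exp (2 * \<alpha> + \<beta>) / real n"
    using assms by (simp only: exp_diff) simp
  show ?thesis
    unfolding sparse_mass_def bernoulli_mass_def 1 2 by simp
qed

definition sparse_model :: "nat \<Rightarrow> real \<Rightarrow> real \<Rightarrow> network measure" where
  "sparse_model n \<alpha> \<beta> = point_measure (networks n) (\<lambda>y. ennreal (sparse_mass n \<alpha> \<beta> y))"

definition sparse_likelihood_maximizer :: "nat \<Rightarrow> network \<Rightarrow> real \<Rightarrow> real \<Rightarrow> bool" where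
  "sparse_likelihood_maximizer n y a b \<longleftrightarrow>
     is_arg_max (\<lambda>(\<alpha>, \<beta>). sparse_mass n \<alpha> \<beta> y) (\<lambda>_. True) (a, b)"

text \<open>
  The value of an estimator is unconstrained at networks whose likelihood has no maximizer.
\<close>

definition is_sparse_mle :: "nat \<Rightarrow> (network \<Rightarrow> real) \<Rightarrow> (network \<Rightarrow> real) \<Rightarrow> bool" where
  "is_sparse_mle n ahat bhat \<longleftrightarrow>
     (\<forall>y\<in>networks n. (\<exists>a b. sparse_likelihood_maximizer n y a b) \<longrightarrow>
        sparse_likelihood_maximizer n y (ahat y) (bhat y))"

text \<open>\<open>X\<^sub>n = O\<^sub>P(1)\<close>; each \<open>X\<^sub>n\<close> may live on its own probability space.\<close>

definition bounded_in_prob ::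
    "(nat \<Rightarrow> 'a measure) \<Rightarrow> (nat \<Rightarrow> 'a \<Rightarrow> 'b::real_normed_vector) \<Rightarrow> bool" where
  "bounded_in_prob M X \<longleftrightarrow>
     (\<forall>\<epsilon>>0. \<exists>C. \<forall>\<^sub>F n in sequentially.
        measure (M n) {\<omega> \<in> space (M n). norm (X n \<omega>) > C} < \<epsilon>)"

definition rate_consistent ::
    "(nat \<Rightarrow> real) \<Rightarrow> (nat \<Rightarrow> 'a measure) \<Rightarrow> (nat \<Rightarrow> 'a \<Rightarrow> 'b::real_normed_vector) \<Rightarrow> 'b \<Rightarrow> bool"
  where
  "rate_consistent r M T \<theta> \<longleftrightarrow> bounded_in_prob M (\<lambda>n \<omega>. r n *\<^sub>R (T n \<omega> - \<theta>))"

text \<open>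
  The library's \<^const>\<open>weak_conv_m\<close> is restricted to measures on the real line, so convergence
  in distribution is defined here by means of bounded continuous test functions.
\<close>

definition converges_in_distribution ::
    "(nat \<Rightarrow> 'a measure) \<Rightarrow> (nat \<Rightarrow> 'a \<Rightarrow> 'b::topological_space) \<Rightarrow> 'b measure \<Rightarrow> bool" where
  "converges_in_distribution M X N \<longleftrightarrow>
     (\<forall>f :: 'b \<Rightarrow> real. continuous_on UNIV f \<longrightarrow> bounded (range f) \<longrightarrow>
        (\<lambda>n. \<integral>\<omega>. f (X n \<omega>) \<partial>M n) \<longlonglongrightarrow> (\<integral>x. f x \<partial>N))"

text \<open>Meant for symmetric positive definite \<open>\<Sigma>\<close>, where the normal distribution has a density.\<close>

definition multivariate_normal :: "real ^ 'n \<Rightarrow> real ^ 'n ^ 'n \<Rightarrow> (real ^ 'n) measure" where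
  "multivariate_normal \<mu> \<Sigma> = density lborel (\<lambda>x. ennreal
     (exp (- ((x - \<mu>) \<bullet> (matrix_inv \<Sigma> *v (x - \<mu>))) / 2) / sqrt ((2 * pi) ^ CARD('n) * det \<Sigma>)))"

end

theory Submission
  imports Defs
begin

text \<open>
  The likelihood of a network depends on it only through two counts: the number \<open>t\<close> of connected
  dyads (those carrying at least one tie) and the number \<open>m\<close> of mutual dyads. Dyads are independent
  under the model, so \<open>t\<close> is binomial, with a success probability of order \<open>1 / n\<close> over about
  \<open>n\<^sup>2 / 2\<close> dyads, and \<open>m\<close> given \<open>t\<close> is binomial over \<open>t\<close> trials with a success probability that
  does not depend on \<open>n\<close> (\<open>sparse_model_counts\<close>). Hence \<open>t\<close> and \<open>m\<close> are of order \<open>n\<close> and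
  fluctuate on the scale \<open>sqrt n\<close>. If all three dyad types occur, the estimator matches the cell
  probabilities with the observed frequencies and is therefore an explicit function of \<open>(t, m)\<close>
  (\<open>sparse_mle_eq\<close>, by the Gibbs inequality).

  Instead of a bivariate central limit theorem, a one-dimensional one
  (\<open>binomial_triangular_CLT\<close>) is used twice, first for \<open>t\<close> and then for \<open>m\<close> given \<open>t\<close>. The two
  uses are combined by the following principle (\<open>lattice_continuous_mapping\<close>): if \<open>X\<^sub>n\<close> converges
  weakly to \<open>X\<close> and the uniformly bounded functions \<open>g\<^sub>n\<close> satisfy \<open>g\<^sub>n x\<^sub>n \<longlonglongrightarrow> g x\<close> whenever
  \<open>x\<^sub>n \<longlonglongrightarrow> x\<close>, then the expectation of \<open>g\<^sub>n X\<^sub>n\<close> converges to that of \<open>g X\<close>. The conditional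
  expectation over \<open>m\<close> is such a \<open>g\<^sub>n\<close> for \<open>t\<close>, by the same principle applied to \<open>m\<close>.

  The test functional to which this is applied is a bounded continuous function of the rescaled
  closed form of the estimator. Only its limit along deterministic sequences of counts is needed,
  and this is the ordinary delta method for the logarithm (\<open>closed_form_mle_limit\<close>). The limit is
  linear in the two independent standard normal limits of the rescaled counts, so the limiting law
  is a linear image of a pair of standard normals (\<open>linear_image_std_normal_pair\<close>), with the
  covariance computed in \<open>limit_matrix_covariance\<close>. Networks that lack a dyad type leave the
  estimator arbitrary. Their probability tends to 0, by the same principle applied to the indicator
  of their counts. Finally, \<open>sqrt n\<close>-consistency is tightness of a weakly convergent sequence.
\<close>

section \<open>A central limit theorem for triangular arrays of binomials\<close>

lemma char_binomial_pmf:
  assumes "p \<in> {0..1}"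
  shows "char (distr (measure_pmf (binomial_pmf N p)) borel (\<lambda>k. (real k - c) / d)) t
    = exp (- \<i> * t * c / d) * (1 - p + p * exp (\<i> * t / d)) ^ N"
proof -
  have "char (distr (measure_pmf (binomial_pmf N p)) borel (\<lambda>k. (real k - c) / d)) t
      = measure_pmf.expectation (binomial_pmf N p) (\<lambda>k. iexp (t * ((real k - c) / d)))"
    unfolding char_def by (subst integral_distr) auto
  also have "\<dots> = (\<Sum>k\<le>N. (real (N choose k) * p ^ k * (1 - p) ^ (N - k)) *\<^sub>R iexp (t * ((real k - c) / d)))"
    by (rule expectation_binomial_pmf'[OF assms])
  also have "\<dots> = (\<Sum>k\<le>N. exp (- \<i> * t * c / d) * (of_nat (N choose k) * (p * exp (\<i> * t / d)) ^ k * (1 - p) ^ (N - k)))"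
  proof (rule sum.cong)
    fix k
    have "iexp (t * ((real k - c) / d)) = exp (- \<i> * t * c / d) * exp (\<i> * t / d) ^ k"
      by (simp add: exp_of_nat_mult[symmetric] exp_add[symmetric] field_simps diff_divide_distrib)
    then show "(real (N choose k) * p ^ k * (1 - p) ^ (N - k)) *\<^sub>R iexp (t * ((real k - c) / d))
      = exp (- \<i> * t * c / d) * (of_nat (N choose k) * (p * exp (\<i> * t / d)) ^ k * (1 - p) ^ (N - k))"
      by (simp add: scaleR_conv_of_real power_mult_distrib)
  qed simp
  also have "\<dots> = exp (- \<i> * t * c / d) * (p * exp (\<i> * t / d) + (1 - p)) ^ N"
    by (simp add: binomial_ring sum_distrib_left)
  finally show ?thesis by (simp add: add.commute)
qed

lemma cmod_one_minus_of_real: "cmod (1 - complex_of_real p) = \<bar>1 - p\<bar>"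
  by (metis norm_of_real of_real_1 of_real_diff)

text \<open>
  A centred Bernoulli variable has variance \<open>p * (1 - p)\<close>, and its third absolute moment is at most
  as large. Both terms of the second-order Taylor expansion thus carry the factor \<open>p * (1 - p)\<close>.
  This keeps the error negligible after multiplication by the number of trials, even if \<open>p\<close> tends
  to 0.
\<close>

lemma char_centred_bernoulli_approx:
  fixes p x :: real
  assumes "p \<in> {0..1}"
  shows "cmod (exp (- \<i> * x * p) * (1 - p + p * exp (\<i> * x)) - (1 - p * (1 - p) * x\<^sup>2 / 2))
    \<le> p * (1 - p) * \<bar>x\<bar> ^ 3"
proof -
  have p: "0 \<le> p" "p \<le> 1" using assms by auto
  define R where "R y = iexp y - (1 + \<i> * y - y\<^sup>2 / 2)" for y :: real
  have R: "cmod (R y) \<le> \<bar>y\<bar> ^ 3 / 6" for y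
    using iexp_approx1[of y 2]
    by (simp add: R_def numeral_2_eq_2 numeral_3_eq_3 atMost_Suc power_mult_distrib algebra_simps fact_numeral)
  have "exp (- \<i> * x * p) * (1 - p + p * exp (\<i> * x)) = (1 - p) * iexp (- x * p) + p * iexp (x * (1 - p))"
    by (simp add: ring_distribs exp_add[symmetric] mult_ac exp_diff[symmetric])
  also have "\<dots> = 1 - p * (1 - p) * x\<^sup>2 / 2 + (1 - p) * R (- x * p) + p * R (x * (1 - p))"
    by (simp add: R_def power2_eq_square field_simps)
  finally have "cmod (exp (- \<i> * x * p) * (1 - p + p * exp (\<i> * x)) - (1 - p * (1 - p) * x\<^sup>2 / 2))
    = cmod ((1 - p) * R (- x * p) + p * R (x * (1 - p)))"
    by (simp only: add.assoc add_diff_cancel_left')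
  also have "\<dots> \<le> (1 - p) * cmod (R (- x * p)) + p * cmod (R (x * (1 - p)))"
    using p cmod_one_minus_of_real[of p] by (intro order_trans[OF norm_triangle_ineq]) (simp add: norm_mult)
  also have "\<dots> \<le> (1 - p) * (\<bar>- x * p\<bar> ^ 3 / 6) + p * (\<bar>x * (1 - p)\<bar> ^ 3 / 6)"
    using p by (intro add_mono mult_left_mono R) auto
  also have "\<dots> = p * (1 - p) * \<bar>x\<bar> ^ 3 * ((p\<^sup>2 + (1 - p)\<^sup>2) / 6)"
  proof -
    have "\<bar>- x * p\<bar> = \<bar>x\<bar> * p" "\<bar>x * (1 - p)\<bar> = \<bar>x\<bar> * (1 - p)"
      using p by (auto simp: abs_mult)
    then show ?thesis
      by (simp only: power_mult_distrib) (simp add: field_simps power2_eq_square power3_eq_cube)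
  qed
  also have "\<dots> \<le> p * (1 - p) * \<bar>x\<bar> ^ 3 * 1"
  proof -
    have "p\<^sup>2 \<le> 1" "(1 - p)\<^sup>2 \<le> 1" using p by (auto simp: power_le_one_iff abs_square_le_1)
    then show ?thesis using p by (intro mult_left_mono) auto
  qed
  finally show ?thesis by simp
qed

lemma exp_minus_approx:
  fixes x :: real
  assumes "0 \<le> x"
  shows "\<bar>exp (- x) - (1 - x)\<bar> \<le> x\<^sup>2"
proof (cases "x \<le> 1")
  case True
  have "1 - x \<le> exp (- x)" using exp_ge_add_one_self[of "- x"] by simp
  moreover have "exp (- x) \<le> 1 - x + x\<^sup>2"
  proof -
    have "exp (-x) * (1 + x) \<le> 1"
      using exp_ge_add_one_self[of x] by (simp add: exp_minus field_simps)
    also have "1 \<le> (1 - x + x\<^sup>2) * (1 + x)"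
      using assms by (simp add: power2_eq_square algebra_simps)
    finally show ?thesis using assms by simp
  qed
  ultimately show ?thesis by simp
next
  case False
  then have "x * 1 \<le> x * x" by (intro mult_left_mono) auto
  moreover have "0 < exp (- x)" "exp (- x) \<le> 1" using assms by auto
  ultimately show ?thesis
    using False unfolding abs_le_iff power2_eq_square by linarith
qed

text \<open>
  The characteristic function is an \<open>N\<close>-th power \<open>z ^ N\<close>. With \<open>x = t / d\<close> the base \<open>z\<close> is compared
  with \<open>exp (- w)\<close>, where \<open>w = p * (1 - p) * x\<^sup>2 / 2\<close>. Numbers in the unit disc satisfy
  \<open>\<bar>z ^ N - u ^ N\<bar> \<le> N * \<bar>z - u\<bar>\<close>, and \<open>N * w\<close> tends to \<open>t\<^sup>2 / 2\<close>.
\<close>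

theorem binomial_triangular_CLT:
  fixes N :: "nat \<Rightarrow> nat" and p d :: "nat \<Rightarrow> real"
  assumes p: "\<And>n. p n \<in> {0..1}"
    and d: "filterlim d at_top sequentially"
    and var: "(\<lambda>n. real (N n) * p n * (1 - p n) / (d n)\<^sup>2) \<longlonglongrightarrow> 1"
  shows "weak_conv_m
    (\<lambda>n. distr (measure_pmf (binomial_pmf (N n) (p n))) borel (\<lambda>k. (real k - real (N n) * p n) / d n))
    std_normal_distribution"
proof (rule levy_continuity)
  show "real_distribution (distr (measure_pmf (binomial_pmf (N n) (p n))) borel
     (\<lambda>k. (real k - real (N n) * p n) / d n))" for n
    by (intro prob_space.real_distribution_distr measure_pmf.prob_space_axioms) simp
  show "real_distribution std_normal_distribution" by (rule real_dist_normal_dist)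
  fix t
  define x where "x n = t / d n" for n
  define v where "v n = p n * (1 - p n)" for n
  define w where "w n = v n * (x n)\<^sup>2 / 2" for n
  define z where "z n = exp (- \<i> * x n * p n) * (1 - p n + p n * exp (\<i> * x n))" for n
  have v: "0 \<le> v n" "v n \<le> 1" for n
    using p[of n] by (auto simp: v_def mult_le_one)
  have w0: "0 \<le> w n" for n using v by (simp add: w_def)
  have x: "x \<longlonglongrightarrow> 0"
    unfolding x_def by (intro tendsto_divide_0[OF tendsto_const] filterlim_at_top_imp_at_infinity d)
  have Nv: "(\<lambda>n. real (N n) * v n * (x n)\<^sup>2) \<longlonglongrightarrow> t\<^sup>2"
    using tendsto_mult[OF var tendsto_const[of "t\<^sup>2"]] by (simp add: v_def x_def power_divide mult_ac)
  have w_lim: "w \<longlonglongrightarrow> 0"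
  proof (rule tendsto_sandwich[of "\<lambda>_. 0" _ _ "\<lambda>n. (x n)\<^sup>2"])
    show "(\<lambda>n. (x n)\<^sup>2) \<longlonglongrightarrow> 0" using tendsto_power[OF x, of 2] by simp
    have "w n \<le> (x n)\<^sup>2" for n
    proof -
      have "v n * (x n)\<^sup>2 \<le> 1 * (x n)\<^sup>2" by (intro mult_right_mono v) auto
      then show ?thesis
        using zero_le_power2[of "x n"] unfolding w_def by linarith
    qed
    then show "\<forall>\<^sub>F n in sequentially. w n \<le> (x n)\<^sup>2" by simp
  qed (use w0 in auto)
  have char_eq: "char (distr (measure_pmf (binomial_pmf (N n) (p n))) borel
      (\<lambda>k. (real k - real (N n) * p n) / d n)) t = z n ^ N n" for n
    by (subst char_binomial_pmf[OF p])
       (simp add: z_def x_def power_mult_distrib exp_of_nat_mult[symmetric] mult_ac)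
  have z1: "cmod (z n) \<le> 1" for n
  proof -
    have "cmod (1 - p n + p n * exp (\<i> * x n)) \<le> (1 - p n) + p n"
      using p[of n] cmod_one_minus_of_real[of "p n"]
      by (intro order_trans[OF norm_triangle_ineq]) (simp add: norm_mult)
    then show ?thesis
      using norm_exp_i_times[of "- x n * p n"] by (simp add: z_def norm_mult mult.assoc)
  qed
  let ?e = "\<lambda>n. real (N n) * v n * (x n)\<^sup>2 * (\<bar>x n\<bar> + w n)"
  have bound: "cmod (z n ^ N n - exp (- (real (N n) * w n))) \<le> ?e n" for n
  proof -
    have "cmod (z n - (1 - w n)) \<le> v n * \<bar>x n\<bar> ^ 3"
      using char_centred_bernoulli_approx[OF p[of n], of "x n"]
      by (simp add: z_def w_def v_def)
    moreover have "cmod ((1 - w n) - complex_of_real (exp (- w n))) \<le> (w n)\<^sup>2"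
    proof -
      have "(1 - w n) - complex_of_real (exp (- w n)) = complex_of_real ((1 - w n) - exp (- w n))"
        by simp
      then show ?thesis
        using exp_minus_approx[OF w0, of n] by (simp only: norm_of_real abs_minus_commute)
    qed
    moreover have "(w n)\<^sup>2 \<le> v n * (x n)\<^sup>2 * w n"
      using mult_right_mono[of "w n" "v n * (x n)\<^sup>2" "w n"] w0[of n] v[of n]
      by (simp add: w_def power2_eq_square)
    ultimately have "cmod (z n - complex_of_real (exp (- w n))) \<le> v n * \<bar>x n\<bar> ^ 3 + v n * (x n)\<^sup>2 * w n"
      using norm_triangle_ineq[of "z n - (1 - w n)" "(1 - w n) - complex_of_real (exp (- w n))"]
      by simp
    also have "\<dots> = v n * (x n)\<^sup>2 * (\<bar>x n\<bar> + w n)"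
      by (simp add: power3_eq_cube power2_eq_square ring_distribs)
    finally have "N n * cmod (z n - complex_of_real (exp (- w n))) \<le> N n * (v n * (x n)\<^sup>2 * (\<bar>x n\<bar> + w n))"
      by (intro mult_left_mono) auto
    moreover have "cmod (z n ^ N n - complex_of_real (exp (- w n)) ^ N n) \<le> N n * cmod (z n - complex_of_real (exp (- w n)))"
      by (rule norm_power_diff) (use z1 w0 in auto)
    moreover have "complex_of_real (exp (- w n)) ^ N n = complex_of_real (exp (- (real (N n) * w n)))"
      using exp_of_nat_mult[of "N n" "- w n"] by simp
    ultimately show ?thesis by (simp add: mult.assoc)
  qed
  have "?e \<longlonglongrightarrow> t\<^sup>2 * (\<bar>0\<bar> + 0)"
    by (intro tendsto_intros Nv x w_lim)
  then have "?e \<longlonglongrightarrow> 0" by simp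
  then have diff: "(\<lambda>n. z n ^ N n - exp (- (real (N n) * w n))) \<longlonglongrightarrow> 0"
    by (rule Lim_null_comparison[OF always_eventually[OF allI[OF bound]]])
  have "(\<lambda>n. - (real (N n) * w n)) \<longlonglongrightarrow> - (t\<^sup>2 / 2)"
    using tendsto_minus[OF tendsto_divide[OF Nv tendsto_const[of 2]]] by (simp add: w_def mult.assoc)
  then have "(\<lambda>n. complex_of_real (exp (- (real (N n) * w n)))) \<longlonglongrightarrow> complex_of_real (exp (- (t\<^sup>2 / 2)))"
    by (intro tendsto_of_real tendsto_exp)
  then have "(\<lambda>n. z n ^ N n) \<longlonglongrightarrow> complex_of_real (exp (- (t\<^sup>2 / 2)))"
    by (rule Lim_transform[OF _ diff])
  then show "(\<lambda>n. char (distr (measure_pmf (binomial_pmf (N n) (p n))) borel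
      (\<lambda>k. (real k - real (N n) * p n) / d n)) t) \<longlonglongrightarrow> char std_normal_distribution t"
    by (simp add: char_eq char_std_normal_distribution)
qed

section \<open>Weak convergence and continuously convergent functionals\<close>

text \<open>
  By Skorohod's theorem the variables may be assumed to converge pointwise, and then dominated
  convergence applies. The functions \<open>g n\<close> live on the lattice index rather than on the real line, so
  the limit is required only along lattice sequences. They are transported to the reals by a right
  inverse of \<open>z n\<close>, which almost surely sees only points of the countable range of \<open>z n\<close>.
\<close>

lemma lattice_continuous_mapping:
  fixes Q :: "nat \<Rightarrow> 'a::countable pmf" and z g :: "nat \<Rightarrow> 'a \<Rightarrow> real" and g' :: "real \<Rightarrow> real"
  assumes weak: "weak_conv_m (\<lambda>n. distr (measure_pmf (Q n)) borel (z n)) \<mu>"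
    and \<mu>: "real_distribution \<mu>"
    and inj: "\<forall>\<^sub>F n in sequentially. inj (z n)"
    and bdd: "\<And>n k. \<bar>g n k\<bar> \<le> B"
    and conv: "\<And>k x. (\<lambda>n. z n (k n)) \<longlonglongrightarrow> x \<Longrightarrow> (\<lambda>n. g n (k n)) \<longlonglongrightarrow> g' x"
    and meas: "g' \<in> borel_measurable borel"
  shows "(\<lambda>n. measure_pmf.expectation (Q n) (g n)) \<longlonglongrightarrow> (\<integral>x. g' x \<partial>\<mu>)"
proof -
  have rd: "real_distribution (distr (measure_pmf (Q n)) borel (z n))" for n
    by (intro prob_space.real_distribution_distr measure_pmf.prob_space_axioms) simp
  obtain \<Omega> :: "real measure" and X :: "nat \<Rightarrow> real \<Rightarrow> real" and X' :: "real \<Rightarrow> real"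
    where "prob_space \<Omega>"
      and sk: "\<forall>n. X n \<in> borel_measurable \<Omega>"
        "\<forall>n. distr \<Omega> borel (X n) = distr (measure_pmf (Q n)) borel (z n)"
        "X' \<in> measurable \<Omega> lborel" "distr \<Omega> borel X' = \<mu>"
        "\<forall>\<omega>\<in>space \<Omega>. (\<lambda>n. X n \<omega>) \<longlonglongrightarrow> X' \<omega>"
    using Skorohod[OF rd \<mu> weak] by blast
  from sk have X [measurable]: "\<And>n. X n \<in> borel_measurable \<Omega>"
    and distr_X: "\<And>n. distr \<Omega> borel (X n) = distr (measure_pmf (Q n)) borel (z n)"
    and X' [measurable]: "X' \<in> borel_measurable \<Omega>"
    and distr_X': "distr \<Omega> borel X' = \<mu>"
    and lim: "\<And>\<omega>. \<omega> \<in> space \<Omega> \<Longrightarrow> (\<lambda>n. X n \<omega>) \<longlonglongrightarrow> X' \<omega>"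
    by simp_all
  interpret \<Omega>: prob_space \<Omega> by fact
  define h where "h n y = g n (inv (z n) y)" for n y
  have h_bdd: "\<bar>h n y\<bar> \<le> B" for n y
    by (simp add: h_def bdd)
  have h [measurable]: "h n \<in> borel_measurable borel" for n
  proof (rule measurable_discrete_difference)
    \<comment> \<open>Off the range of \<open>z n\<close> the right inverse is the constant choice from the empty set,
        so \<open>h n\<close> is constant outside a countable set.\<close>
    show "(\<lambda>_. g n (SOME k. False)) \<in> borel_measurable borel" by simp
    show "countable (range (z n))" by simp
    have "(\<lambda>k. z n k = y) = (\<lambda>k. False)" if "y \<notin> range (z n)" for y
      using that by auto
    then show "g n (SOME k. False) = h n y" if "y \<notin> range (z n)" for y
      using that by (simp add: h_def inv_into_def)
  qed auto
  note [measurable] = meas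
  have "AE \<omega> in \<Omega>. X n \<omega> \<in> range (z n)" for n
  proof -
    have [measurable]: "range (z n) \<in> sets borel"
      by (rule sets.countable) auto
    have "AE y in distr \<Omega> borel (X n). y \<in> range (z n)"
      unfolding distr_X by (subst AE_distr_iff) auto
    then show ?thesis by (subst (asm) AE_distr_iff) auto
  qed
  then have "AE \<omega> in \<Omega>. \<forall>n. X n \<omega> \<in> range (z n)"
    by (simp add: AE_all_countable)
  then have ae: "AE \<omega> in \<Omega>. (\<lambda>n. h n (X n \<omega>)) \<longlonglongrightarrow> g' (X' \<omega>)"
  proof (rule AE_mp, intro AE_I2 impI)
    fix \<omega> assume "\<omega> \<in> space \<Omega>" "\<forall>n. X n \<omega> \<in> range (z n)"
    then have "(\<lambda>n. z n (inv (z n) (X n \<omega>))) \<longlonglongrightarrow> X' \<omega>"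
      using lim by (simp add: f_inv_into_f)
    then show "(\<lambda>n. h n (X n \<omega>)) \<longlonglongrightarrow> g' (X' \<omega>)"
      unfolding h_def by (rule conv)
  qed
  have "(\<lambda>n. \<integral>\<omega>. h n (X n \<omega>) \<partial>\<Omega>) \<longlonglongrightarrow> (\<integral>\<omega>. g' (X' \<omega>) \<partial>\<Omega>)"
    by (rule integral_dominated_convergence[where w = "\<lambda>_. B"]) (use ae h_bdd in auto)
  moreover have "(\<integral>\<omega>. g' (X' \<omega>) \<partial>\<Omega>) = (\<integral>x. g' x \<partial>\<mu>)"
    by (simp add: distr_X'[symmetric] integral_distr)
  moreover have "\<forall>\<^sub>F n in sequentially. (\<integral>\<omega>. h n (X n \<omega>) \<partial>\<Omega>) = measure_pmf.expectation (Q n) (g n)"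
    using inj
  proof eventually_elim
    case (elim n)
    have "(\<integral>\<omega>. h n (X n \<omega>) \<partial>\<Omega>) = (\<integral>y. h n y \<partial>distr \<Omega> borel (X n))"
      by (simp add: integral_distr)
    also have "\<dots> = measure_pmf.expectation (Q n) (\<lambda>k. h n (z n k))"
      unfolding distr_X by (simp add: integral_distr)
    finally show ?case using elim by (simp add: h_def)
  qed
  ultimately show ?thesis
    by (simp add: tendsto_cong)
qed

definition thinned_binomial_pmf :: "nat \<Rightarrow> real \<Rightarrow> real \<Rightarrow> (nat \<times> nat) pmf" where
  "thinned_binomial_pmf N p r = do {t \<leftarrow> binomial_pmf N p; m \<leftarrow> binomial_pmf t r; return_pmf (t, m)}"

lemma expectation_bind_pmf:
  fixes f :: "'a \<Rightarrow> real"
  assumes "\<And>x. \<bar>f x\<bar> \<le> B"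
  shows "measure_pmf.expectation (Q \<bind> R) f = measure_pmf.expectation Q (\<lambda>x. measure_pmf.expectation (R x) f)"
  unfolding measure_pmf_bind
  by (rule integral_bind[where K = "count_space UNIV" and B = B and B' = 1])
     (use assms measurable_measure_pmf[of R] in \<open>auto simp: measure_pmf.emeasure_space_1 measure_pmf.finite_measure_axioms\<close>)

lemma expectation_thinned_binomial:
  fixes F :: "nat \<times> nat \<Rightarrow> real"
  assumes "\<And>x. \<bar>F x\<bar> \<le> B"
  shows "measure_pmf.expectation (thinned_binomial_pmf N p r) F =
    measure_pmf.expectation (binomial_pmf N p) (\<lambda>t. measure_pmf.expectation (binomial_pmf t r) (\<lambda>m. F (t, m)))"
  by (simp add: thinned_binomial_pmf_def expectation_bind_pmf[OF assms])

lemma LIMSEQ_mean_sqrt_deviation: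
  fixes t a :: "nat \<Rightarrow> real"
  assumes dev: "(\<lambda>n. (t n - a n) / sqrt (c * real n)) \<longlonglongrightarrow> x"
    and mean: "(\<lambda>n. a n / real n) \<longlonglongrightarrow> l" and c: "0 < c"
  shows "(\<lambda>n. t n / real n) \<longlonglongrightarrow> l"
proof -
  have "(\<lambda>n. sqrt c / sqrt (real n)) \<longlonglongrightarrow> 0"
    by real_asymp
  from tendsto_add[OF mean tendsto_mult[OF dev this]]
  have "(\<lambda>n. a n / real n + (t n - a n) / sqrt (c * real n) * (sqrt c / sqrt (real n))) \<longlonglongrightarrow> l"
    by simp
  moreover have "\<forall>\<^sub>F n in sequentially. a n / real n + (t n - a n) / sqrt (c * real n) * (sqrt c / sqrt (real n)) = t n / real n"
    using eventually_gt_at_top[of 0]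
    by eventually_elim (use c in \<open>simp add: real_sqrt_mult field_simps\<close>)
  ultimately show ?thesis by (simp add: tendsto_cong)
qed

text \<open>
  Given that the rescaled \<open>t\<close> converges, \<open>t / n\<close> converges to \<open>l\<close>. Hence \<open>m\<close>, a binomial over \<open>t\<close>
  trials, has a conditional variance asymptotic to \<open>l * r * (1 - r) * n\<close>, whatever the limit of the
  rescaled \<open>t\<close> is. For this reason the two normal limits are independent.
\<close>

theorem thinned_binomial_continuous_mapping:
  fixes N :: "nat \<Rightarrow> nat" and p :: "nat \<Rightarrow> real" and F :: "nat \<Rightarrow> nat \<times> nat \<Rightarrow> real"
  assumes p: "\<And>n. p n \<in> {0..1}" and r: "0 < r" "r < 1" and l: "0 < l"
    and mean: "(\<lambda>n. real (N n) * p n / real n) \<longlonglongrightarrow> l" and p0: "p \<longlonglongrightarrow> 0"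
    and bdd: "\<And>n x. \<bar>F n x\<bar> \<le> B"
    and conv: "\<And>t m x y.
      (\<lambda>n. (real (t n) - real (N n) * p n) / sqrt (l * real n)) \<longlonglongrightarrow> x \<Longrightarrow>
      (\<lambda>n. (real (m n) - real (t n) * r) / sqrt (l * r * (1 - r) * real n)) \<longlonglongrightarrow> y \<Longrightarrow>
      (\<lambda>n. F n (t n, m n)) \<longlonglongrightarrow> G (x, y)"
    and meas: "G \<in> borel_measurable (borel \<Otimes>\<^sub>M borel)"
  shows "(\<lambda>n. measure_pmf.expectation (thinned_binomial_pmf (N n) (p n) r) (F n))
    \<longlonglongrightarrow> (\<integral>x. \<integral>y. G (x, y) \<partial>std_normal_distribution \<partial>std_normal_distribution)"
proof -
  interpret std: real_distribution std_normal_distribution by (rule real_dist_normal_dist)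
  note [measurable] = meas
  have d: "filterlim (\<lambda>n. sqrt (c * real n)) at_top sequentially" if "0 < c" for c
    using that by real_asymp
  have inj: "\<forall>\<^sub>F n in sequentially. inj (\<lambda>k. (real k - a n) / sqrt (c * real n))" if "0 < c" for a c
    using eventually_gt_at_top[of 0] by eventually_elim (use that in \<open>auto intro!: injI\<close>)
  have "(\<lambda>n. measure_pmf.expectation (binomial_pmf (N n) (p n))
        (\<lambda>t. measure_pmf.expectation (binomial_pmf t r) (\<lambda>m. F n (t, m))))
    \<longlonglongrightarrow> (\<integral>x. \<integral>y. G (x, y) \<partial>std_normal_distribution \<partial>std_normal_distribution)"
  proof (rule lattice_continuous_mapping[where z = "\<lambda>n k. (real k - real (N n) * p n) / sqrt (l * real n)" and B = B])
    show "weak_conv_m (\<lambda>n. distr (measure_pmf (binomial_pmf (N n) (p n))) borel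
        (\<lambda>k. (real k - real (N n) * p n) / sqrt (l * real n))) std_normal_distribution"
    proof (rule binomial_triangular_CLT[OF p d[OF l]])
      have "(\<lambda>n. real (N n) * p n / real n * ((1 - p n) / l)) \<longlonglongrightarrow> l * ((1 - 0) / l)"
        using l by (intro tendsto_intros mean p0) auto
      moreover have "\<forall>\<^sub>F n in sequentially. real (N n) * p n / real n * ((1 - p n) / l)
          = real (N n) * p n * (1 - p n) / (sqrt (l * real n))\<^sup>2"
        using eventually_gt_at_top[of 0] by eventually_elim (use l in \<open>simp add: field_simps\<close>)
      ultimately show "(\<lambda>n. real (N n) * p n * (1 - p n) / (sqrt (l * real n))\<^sup>2) \<longlonglongrightarrow> 1"
        using l by (simp add: mult.commute)
    qed
  next
    fix t x
    assume t: "(\<lambda>n. (real (t n) - real (N n) * p n) / sqrt (l * real n)) \<longlonglongrightarrow> x"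
    have tn: "(\<lambda>n. real (t n) / real n) \<longlonglongrightarrow> l"
      by (rule LIMSEQ_mean_sqrt_deviation[OF t mean l])
    have c: "0 < l * r * (1 - r)" using l r by simp
    show "(\<lambda>n. measure_pmf.expectation (binomial_pmf (t n) r) (\<lambda>m. F n (t n, m)))
        \<longlonglongrightarrow> (\<integral>y. G (x, y) \<partial>std_normal_distribution)"
    proof (rule lattice_continuous_mapping[where z = "\<lambda>n k. (real k - real (t n) * r) / sqrt (l * r * (1 - r) * real n)" and B = B])
      show "weak_conv_m (\<lambda>n. distr (measure_pmf (binomial_pmf (t n) r)) borel
          (\<lambda>k. (real k - real (t n) * r) / sqrt (l * r * (1 - r) * real n))) std_normal_distribution"
      proof (rule binomial_triangular_CLT[OF _ d[OF c]])
        have "(\<lambda>n. real (t n) / real n * (1 / l)) \<longlonglongrightarrow> l * (1 / l)"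
          by (intro tendsto_intros tn)
        moreover have "\<forall>\<^sub>F n in sequentially. real (t n) / real n * (1 / l)
            = real (t n) * r * (1 - r) / (sqrt (l * r * (1 - r) * real n))\<^sup>2"
          using eventually_gt_at_top[of 0] by eventually_elim (use l r in \<open>simp add: divide_simps\<close>)
        ultimately show "(\<lambda>n. real (t n) * r * (1 - r) / (sqrt (l * r * (1 - r) * real n))\<^sup>2) \<longlonglongrightarrow> 1"
          using l by (simp add: tendsto_cong)
      qed (use r in auto)
      show "(\<lambda>n. F n (t n, m n)) \<longlonglongrightarrow> G (x, y)"
        if "(\<lambda>n. (real (m n) - real (t n) * r) / sqrt (l * r * (1 - r) * real n)) \<longlonglongrightarrow> y" for m y
        by (rule conv[OF t that])
    qed (use bdd inj[OF c] real_dist_normal_dist in auto)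
  next
    show "\<bar>measure_pmf.expectation (binomial_pmf t r) (\<lambda>m. F n (t, m))\<bar> \<le> B" for n t
      by (rule order_trans[OF integral_abs_bound measure_pmf.integral_le_const]) (use bdd r in auto)
  qed (use inj[OF l] real_dist_normal_dist in auto)
  then show ?thesis
    by (simp add: expectation_thinned_binomial[OF bdd])
qed

section \<open>Convergence in distribution implies boundedness in probability\<close>

text \<open>
  Tightness: the continuous functions \<open>f k\<close> below vanish on the ball of radius \<open>k\<close> and equal 1
  outside the ball of radius \<open>k + 1\<close>. Their limiting expectations decrease to 0 with growing \<open>k\<close>.
\<close>

lemma bounded_in_prob_of_converges_in_distribution:
  fixes X :: "nat \<Rightarrow> 'a \<Rightarrow> 'b::{real_normed_vector, second_countable_topology}"
  assumes conv: "converges_in_distribution M X P"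
    and P: "prob_space P" "sets P = sets borel"
    and M: "\<forall>\<^sub>F n in sequentially. prob_space (M n) \<and> X n \<in> borel_measurable (M n)"
  shows "bounded_in_prob M X"
  unfolding bounded_in_prob_def
proof (intro allI impI)
  fix \<epsilon> :: real assume \<epsilon>: "0 < \<epsilon>"
  interpret P: prob_space P by fact
  note [measurable_cong] = P(2)
  define f where "f k x = min 1 (max 0 (norm x - real k))" for k and x :: 'b
  have cont: "continuous_on UNIV (f k)" for k
    unfolding f_def by (intro continuous_intros)
  then have [measurable]: "f k \<in> borel_measurable borel" for k
    by (rule borel_measurable_continuous_onI)
  have f01: "0 \<le> f k x" "f k x \<le> 1" for k x by (auto simp: f_def)
  have "(\<lambda>k. \<integral>x. f k x \<partial>P) \<longlonglongrightarrow> (\<integral>x. 0 \<partial>P)"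
  proof (rule integral_dominated_convergence[where w = "\<lambda>_. 1"])
    have "\<forall>\<^sub>F k in sequentially. f k x = 0" for x
    proof -
      obtain k0 where "norm x \<le> real k0" using real_arch_simple by blast
      then show ?thesis
        unfolding eventually_sequentially by (intro exI[of _ k0]) (auto simp: f_def)
    qed
    then show "AE x in P. (\<lambda>k. f k x) \<longlonglongrightarrow> 0"
      by (intro AE_I2 tendsto_eventually)
  qed (use f01 in auto)
  then have "\<forall>\<^sub>F k in sequentially. (\<integral>x. f k x \<partial>P) < \<epsilon>"
    using \<epsilon> by (intro order_tendstoD(2)) auto
  then obtain k where k: "(\<integral>x. f k x \<partial>P) < \<epsilon>"
    by (auto simp: eventually_sequentially)
  have "\<bar>f k x\<bar> \<le> 1" for x
    using f01[of k x] by simp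
  then have "bounded (range (f k))"
    by (intro boundedI[of _ 1]) auto
  then have "(\<lambda>n. \<integral>\<omega>. f k (X n \<omega>) \<partial>M n) \<longlonglongrightarrow> (\<integral>x. f k x \<partial>P)"
    using conv cont unfolding converges_in_distribution_def by blast
  then have "\<forall>\<^sub>F n in sequentially. (\<integral>\<omega>. f k (X n \<omega>) \<partial>M n) < \<epsilon>"
    using k by (rule order_tendstoD(2))
  then have "\<forall>\<^sub>F n in sequentially. measure (M n) {\<omega> \<in> space (M n). norm (X n \<omega>) > real k + 1} < \<epsilon>"
    using M
  proof eventually_elim
    case (elim n)
    interpret prob_space "M n" using elim by simp
    have [measurable]: "X n \<in> borel_measurable (M n)" using elim by simp
    have "measure (M n) {\<omega> \<in> space (M n). norm (X n \<omega>) > real k + 1}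
        = (\<integral>\<omega>. indicator {\<omega> \<in> space (M n). norm (X n \<omega>) > real k + 1} \<omega> \<partial>M n)"
      by simp
    also have "\<dots> \<le> (\<integral>\<omega>. f k (X n \<omega>) \<partial>M n)"
    proof (rule integral_mono)
      show "integrable (M n) (\<lambda>\<omega>. f k (X n \<omega>))"
        by (rule integrable_const_bound[where B = 1]) (use f01 in auto)
      show "indicator {\<omega> \<in> space (M n). norm (X n \<omega>) > real k + 1} \<omega> \<le> f k (X n \<omega>)" for \<omega>
        using f01(1) by (auto simp: indicator_def f_def)
    qed (auto intro!: integrable_real_indicator simp: emeasure_eq_measure)
    finally show ?case using elim by simp
  qed
  then show "\<exists>C. \<forall>\<^sub>F n in sequentially. measure (M n) {\<omega> \<in> space (M n). norm (X n \<omega>) > C} < \<epsilon>" ..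
qed

section \<open>Linear images of a pair of independent standard normals\<close>

lemma measurable_vector_2:
  "(\<lambda>(x, y). vector [x, y] :: real ^ 2) \<in> borel_measurable (lborel \<Otimes>\<^sub>M lborel)"
proof -
  have "(\<lambda>(x, y). vector [x, y] :: real ^ 2) = (\<lambda>p. fst p *\<^sub>R axis 1 1 + snd p *\<^sub>R axis 2 1)"
    by (auto simp: fun_eq_iff vec_eq_iff forall_2 axis_def)
  then have "continuous_on UNIV (\<lambda>(x, y). vector [x, y] :: real ^ 2)"
    by (auto intro!: continuous_intros)
  then show ?thesis
    by (simp add: lborel_prod borel_measurable_continuous_onI)
qed

lemma lborel_vector_2:
  "distr (lborel \<Otimes>\<^sub>M lborel) borel (\<lambda>(x, y). vector [x, y] :: real ^ 2) = lborel"
proof (rule lborel_eqI[symmetric])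
  let ?v = "\<lambda>(x, y). vector [x, y] :: real ^ 2"
  note [measurable] = measurable_vector_2
  fix l u :: "real ^ 2"
  assume lu: "\<And>b. b \<in> Basis \<Longrightarrow> l \<bullet> b \<le> u \<bullet> b"
  then have le: "l $ 1 \<le> u $ 1" "l $ 2 \<le> u $ 2"
    by (auto simp: cart_eq_inner_axis Basis_vec_def)
  have "?v -` box l u = {l $ 1<..<u $ 1} \<times> {l $ 2<..<u $ 2}"
    by (auto simp: mem_box_cart forall_2)
  then have "emeasure (distr (lborel \<Otimes>\<^sub>M lborel) borel ?v) (box l u)
     = emeasure lborel {l $ 1<..<u $ 1} * emeasure lborel {l $ 2<..<u $ 2}"
    by (simp add: emeasure_distr space_pair_measure lborel.emeasure_pair_measure_Times)
  also have "\<dots> = (\<Prod>b\<in>Basis. (u - l) \<bullet> b)"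
    using le by (simp add: Basis_vec_def image_UN UNIV_2 cart_eq_inner_axis[symmetric] axis_eq_axis ennreal_mult inner_diff_left mult.commute)
  finally show "emeasure (distr (lborel \<Otimes>\<^sub>M lborel) borel ?v) (box l u) = (\<Prod>b\<in>Basis. (u - l) \<bullet> b)" .
qed simp

text \<open>
  Both sides agree on boxes, because the preimage of a box under \<open>L\<close> is its image under the inverse
  matrix, whose determinant is the reciprocal one.
\<close>

lemma lborel_linear_image:
  fixes L :: "real ^ 'n::{finite,wellorder} ^ 'n::{finite,wellorder}"
  assumes "det L \<noteq> 0"
  shows "density (distr lborel borel (\<lambda>x. L *v x)) (\<lambda>_. ennreal \<bar>det L\<bar>) = lborel"
proof (rule lborel_eqI[symmetric])
  obtain L' where L': "L ** L' = mat 1" "L' ** L = mat 1"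
    using assms invertible_det_nz invertible_def by metis
  have det': "\<bar>det L\<bar> * \<bar>det L'\<bar> = 1"
    using L' by (metis abs_mult abs_one det_I det_mul)
  have [measurable]: "(\<lambda>x. L *v x) \<in> borel_measurable borel"
    by (intro borel_measurable_continuous_onI linear_continuous_on bounded_linear.linear) auto
  fix l u :: "real ^ 'n::{finite,wellorder}"
  assume lu: "\<And>b. b \<in> Basis \<Longrightarrow> l \<bullet> b \<le> u \<bullet> b"
  have pre: "(\<lambda>x. L *v x) -` box l u = (\<lambda>x. L' *v x) ` box l u"
  proof safe
    fix x assume "L *v x \<in> box l u"
    moreover have "x = L' *v (L *v x)"
      by (simp add: matrix_vector_mul_assoc L')
    ultimately show "x \<in> (\<lambda>x. L' *v x) ` box l u" by blast
  qed (simp add: matrix_vector_mul_assoc L')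
  have lin: "linear ((*v) L')" by simp
  have "emeasure lborel ((\<lambda>x. L *v x) -` box l u) = emeasure lebesgue ((\<lambda>x. L *v x) -` box l u)"
    using measurable_sets_borel[of "\<lambda>x. L *v x" borel "box l u"] by simp
  also have "\<dots> = ennreal (measure lebesgue ((\<lambda>x. L' *v x) ` box l u))"
    unfolding pre by (intro emeasure_eq_measure2 measurable_linear_image lin lmeasurable_box)
  also have "\<dots> = ennreal (\<bar>det L'\<bar> * (\<Prod>b\<in>Basis. (u - l) \<bullet> b))"
    using lu by (simp add: measure_linear_image[OF lin lmeasurable_box])
  finally have "ennreal \<bar>det L\<bar> * emeasure lborel ((\<lambda>x. L *v x) -` box l u) = ennreal (\<Prod>b\<in>Basis. (u - l) \<bullet> b)"
    using det' by (simp add: ennreal_mult'[symmetric] mult.assoc[symmetric])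
  then show "emeasure (density (distr lborel borel (\<lambda>x. L *v x)) (\<lambda>_. ennreal \<bar>det L\<bar>)) (box l u) = (\<Prod>b\<in>Basis. (u - l) \<bullet> b)"
    by (simp add: emeasure_density emeasure_distr nn_integral_cmult_indicator)
qed simp

text \<open>
  The density of the image at \<open>L *v v\<close> is the standard normal density at \<open>v\<close> divided by
  \<open>\<bar>det L\<bar>\<close>. It has the required form because the quadratic form of the inverse of
  \<open>L ** transpose L\<close>, taken at \<open>L *v v\<close>, is \<open>v \<bullet> v\<close>.
\<close>

lemma linear_image_std_normal_pair:
  fixes L :: "real ^ 2 ^ 2"
  assumes "det L \<noteq> 0"
  shows "distr (std_normal_distribution \<Otimes>\<^sub>M std_normal_distribution) borel
           (\<lambda>(x, y). L *v vector [x, y]) = multivariate_normal 0 (L ** transpose L)"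
proof -
  let ?v = "\<lambda>(x, y). vector [x, y] :: real ^ 2"
  let ?S = "L ** transpose L"
  define d where "d = (\<lambda>x::real^2. exp (- (x \<bullet> (matrix_inv ?S *v x)) / 2) / sqrt ((2 * pi)\<^sup>2 * det ?S))"
  have quad: "(L *v x) \<bullet> (matrix_inv ?S *v (L *v x)) = x \<bullet> x" for x
  proof -
    have inv: "invertible ?S" "invertible L"
      using assms by (simp_all add: invertible_det_nz det_mul)
    define z where "z = matrix_inv ?S *v (L *v x)"
    have "?S *v z = L *v x"
      using someI_ex[OF inv(1)[unfolded invertible_def]]
      by (simp add: z_def matrix_vector_mul_assoc matrix_mul_assoc matrix_inv_def)
    then have "L *v (transpose L *v z) = L *v x"
      by (simp only: matrix_vector_mul_assoc)
    then have "transpose L *v z = x"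
      using inv(2) by (metis invertible_def matrix_vector_mul_assoc matrix_vector_mul_lid)
    then have "(L *v x) \<bullet> z = x \<bullet> x"
      by (metis dot_lmul_matrix inner_commute vector_transpose_matrix transpose_transpose)
    then show ?thesis by (simp add: z_def)
  qed
  have dens: "ennreal \<bar>det L\<bar> * ennreal (d (L *v ?v p))
      = (case p of (x, y) \<Rightarrow> ennreal (std_normal_density x) * ennreal (std_normal_density y))" for p
  proof -
    obtain x y where p: "p = (x, y)" by force
    have "sqrt ((2 * pi)\<^sup>2 * det ?S) = 2 * pi * \<bar>det L\<bar>"
      by (simp add: det_mul real_sqrt_mult)
    moreover have "(?v p) \<bullet> (?v p) = x\<^sup>2 + y\<^sup>2"
      by (simp add: p inner_vec_def sum_2 power2_eq_square)
    ultimately have "\<bar>det L\<bar> * d (L *v ?v p) = exp (- (x\<^sup>2 + y\<^sup>2) / 2) / (2 * pi)"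
      using assms unfolding d_def quad by simp
    also have "\<dots> = std_normal_density x * std_normal_density y"
      by (simp add: normal_density_def exp_add[symmetric] add_divide_distrib)
    finally have "ennreal (\<bar>det L\<bar> * d (L *v ?v p)) = ennreal (std_normal_density x) * ennreal (std_normal_density y)"
      by (simp only: ennreal_mult normal_density_nonneg)
    moreover have "ennreal (\<bar>det L\<bar> * d (L *v ?v p)) = ennreal \<bar>det L\<bar> * ennreal (d (L *v ?v p))"
      by (rule ennreal_mult') simp
    ultimately show ?thesis
      by (simp only: p prod.case)
  qed
  have L [measurable]: "(\<lambda>x. L *v x) \<in> borel_measurable borel"
    by (intro borel_measurable_continuous_onI linear_continuous_on bounded_linear.linear) auto
  have v [measurable]: "?v \<in> borel_measurable (lborel \<Otimes>\<^sub>M lborel)"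
    by (rule measurable_vector_2)
  have [measurable]: "d \<in> borel_measurable borel"
    using assms unfolding d_def by (intro borel_measurable_continuous_onI continuous_intros linear_continuous_on) (auto simp: det_mul)
  have "std_normal_distribution \<Otimes>\<^sub>M std_normal_distribution
      = density (lborel \<Otimes>\<^sub>M lborel) (\<lambda>p. ennreal \<bar>det L\<bar> * ennreal (d (L *v ?v p)))"
    unfolding dens
    by (rule pair_measure_density) (auto intro: lborel.sigma_finite_measure_axioms prob_space_imp_sigma_finite prob_space_normal_density[of 1 0, simplified])
  then have "distr (std_normal_distribution \<Otimes>\<^sub>M std_normal_distribution) borel (\<lambda>p. L *v ?v p)
      = distr (distr (density (lborel \<Otimes>\<^sub>M lborel) (\<lambda>p. ennreal \<bar>det L\<bar> * ennreal (d (L *v ?v p)))) borel ?v)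
          borel (\<lambda>x. L *v x)"
    by (simp add: distr_distr comp_def)
  also have "\<dots> = distr (density lborel (\<lambda>x. ennreal \<bar>det L\<bar> * ennreal (d (L *v x)))) borel (\<lambda>x. L *v x)"
    by (subst density_distr[symmetric]) (simp_all add: lborel_vector_2)
  also have "\<dots> = density (distr lborel borel (\<lambda>x. L *v x)) (\<lambda>x. ennreal \<bar>det L\<bar> * ennreal (d x))"
    by (subst density_distr) simp_all
  also have "\<dots> = density (density (distr lborel borel (\<lambda>x. L *v x)) (\<lambda>_. ennreal \<bar>det L\<bar>)) d"
    by (subst density_density_eq) simp_all
  also have "\<dots> = multivariate_normal 0 ?S"
    by (simp add: lborel_linear_image[OF assms] multivariate_normal_def d_def)
  finally show ?thesis by (simp add: case_prod_unfold)
qed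

section \<open>Dyad counts of the sparse model\<close>

text \<open>
  A dyad is first connected or not, then mutual or not, and a dyad that is not mutual gets a fair
  orientation. This staging turns the counts into nested binomials. The pair records the tie
  from the smaller to the larger vertex and then the tie in the opposite direction.
\<close>

definition dyad_pmf :: "real \<Rightarrow> real \<Rightarrow> (bool \<times> bool) pmf" where
  "dyad_pmf p r = do {b \<leftarrow> bernoulli_pmf p; c \<leftarrow> bernoulli_pmf r; s \<leftarrow> bernoulli_pmf (1 / 2);
     return_pmf (if \<not> b then (False, False) else if c then (True, True) else (s, \<not> s))}"

lemma pmf_dyad_pmf:
  assumes "p \<in> {0..1}" "r \<in> {0..1}"
  shows "pmf (dyad_pmf p r) w =
    (case w of (True, True) \<Rightarrow> p * r | (False, False) \<Rightarrow> 1 - p | _ \<Rightarrow> p * (1 - r) / 2)"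
  using assms by (cases w rule: prod.exhaust)
    (auto simp: dyad_pmf_def pmf_bind integral_bernoulli_pmf split: bool.splits)

definition dyad_counts :: "'d set \<Rightarrow> ('d \<Rightarrow> bool \<times> bool) \<Rightarrow> nat \<times> nat" where
  "dyad_counts D w = (card {d \<in> D. w d \<noteq> (False, False)}, card {d \<in> D. w d = (True, True)})"

lemma dyad_counts_insert:
  assumes "finite D" "x \<notin> D"
  shows "dyad_counts (insert x D) (w(x := s)) =
    (case dyad_counts D w of (t, m) \<Rightarrow> (t + of_bool (s \<noteq> (False, False)), m + of_bool (s = (True, True))))"
proof -
  have "{d \<in> insert x D. P ((w(x := s)) d)} = (if P s then insert x {d \<in> D. P (w d)} else {d \<in> D. P (w d)})" for P
    using assms by auto
  then have card: "card {d \<in> insert x D. P ((w(x := s)) d)} = card {d \<in> D. P (w d)} + of_bool (P s)" for P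
    using assms by simp
  show ?thesis
    using card[of "\<lambda>v. v \<noteq> (False, False)"] card[of "\<lambda>v. v = (True, True)"]
    by (simp only: dyad_counts_def prod.case)
qed

text \<open>
  Adding one dyad adds one trial to the outer binomial and, if this trial succeeds, one trial to the
  inner binomial. As inner and outer trials are independent, the new trials can be drawn first.
\<close>

lemma thinned_binomial_pmf_Suc:
  assumes "p \<in> {0..1}" "r \<in> {0..1}"
  shows "thinned_binomial_pmf (Suc N) p r =
    do {s \<leftarrow> dyad_pmf p r; (t, m) \<leftarrow> thinned_binomial_pmf N p r;
        return_pmf (t + of_bool (s \<noteq> (False, False)), m + of_bool (s = (True, True)))}"
proof -
  have "do {t \<leftarrow> binomial_pmf N p; m \<leftarrow> binomial_pmf (of_bool b + t) r; return_pmf (of_bool b + t, m)}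
     = do {c \<leftarrow> bernoulli_pmf r; t \<leftarrow> binomial_pmf N p; m \<leftarrow> binomial_pmf t r;
           return_pmf (t + of_bool b, m + of_bool (b \<and> c))}" for b
  proof (cases b)
    case True
    then show ?thesis
      by (subst bind_commute_pmf)
         (use assms in \<open>simp add: binomial_pmf_Suc bind_assoc_pmf bind_return_pmf add.commute of_bool_def\<close>)
  qed simp
  moreover have "(case if \<not> b then (False, False) else if c then (True, True) else (s, \<not> s) of s \<Rightarrow>
      return_pmf (t + of_bool (s \<noteq> (False, False)), m + of_bool (s = (True, True))))
    = return_pmf (t + of_bool b, m + of_bool (b \<and> c))" for b c s and t m :: nat
    by auto
  ultimately show ?thesis
    using assms
    by (simp add: thinned_binomial_pmf_def dyad_pmf_def binomial_pmf_Suc bind_assoc_pmf bind_return_pmf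
        of_bool_def[symmetric] cong: bind_pmf_cong_simp)
qed

lemma map_dyad_counts_Pi_pmf:
  assumes "finite D" "p \<in> {0..1}" "r \<in> {0..1}"
  shows "map_pmf (dyad_counts D) (Pi_pmf D (False, False) (\<lambda>_. dyad_pmf p r)) = thinned_binomial_pmf (card D) p r"
  using assms(1)
proof induction
  case empty
  then show ?case
    using assms by (simp add: dyad_counts_def thinned_binomial_pmf_def binomial_pmf_0 bind_return_pmf)
next
  case (insert x D)
  then show ?case
    using assms
    by (simp add: Pi_pmf_insert' thinned_binomial_pmf_Suc insert.IH[symmetric] map_bind_pmf
        bind_map_pmf dyad_counts_insert bind_assoc_pmf bind_return_pmf map_pmf_def case_prod_unfold)
qed

lemma finite_dyads: "finite (dyads n)"
  by (rule finite_subset[of _ "{1..n} \<times> {1..n}"]) (auto simp: dyads_def)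

lemma card_dyads: "real (card (dyads n)) = real n * (real n - 1) / 2"
proof (induction n)
  case (Suc n)
  have "dyads (Suc n) = dyads n \<union> (\<lambda>i. (i, Suc n)) ` {1..n}"
    by (auto simp: dyads_def le_Suc_eq)
  moreover have "dyads n \<inter> (\<lambda>i. (i, Suc n)) ` {1..n} = {}"
    by (auto simp: dyads_def)
  moreover have "card ((\<lambda>i. (i, Suc n)) ` {1..n}) = n"
    by (simp add: card_image inj_on_def)
  ultimately have "card (dyads (Suc n)) = card (dyads n) + n"
    by (simp add: card_Un_disjoint finite_dyads)
  with Suc show ?case by (simp add: field_simps)
qed (simp add: dyads_def)

definition dyad_config :: "nat \<Rightarrow> network \<Rightarrow> nat \<times> nat \<Rightarrow> bool \<times> bool" where
  "dyad_config n y = (\<lambda>(i, j). if (i, j) \<in> dyads n then (y i j = 1, y j i = 1) else (False, False))"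

lemma networks_entry: "y \<in> networks n \<Longrightarrow> y i j = 0 \<or> y i j = 1"
  unfolding networks_def by blast

lemma tie_iff_dyad_config:
  assumes "y \<in> networks n"
  shows "y i j = 1 \<longleftrightarrow> ((i, j) \<in> dyads n \<and> fst (dyad_config n y (i, j))) \<or>
    ((j, i) \<in> dyads n \<and> snd (dyad_config n y (j, i)))"
proof -
  have "(i, j) \<in> dyads n \<or> (j, i) \<in> dyads n" if "y i j = 1"
  proof -
    have "i \<in> {1..n} \<and> j \<in> {1..n} \<and> i \<noteq> j"
      using assms that unfolding networks_def by blast
    then show ?thesis by (auto simp: dyads_def)
  qed
  then show ?thesis
    by (auto simp: dyad_config_def)
qed

text \<open>
  A network is determined by its configuration on each unordered pair of vertices, and every choice
  of configurations occurs. Sums over networks thus become sums over the support of a product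
  distribution.
\<close>

lemma bij_betw_dyad_config:
  "bij_betw (dyad_config n) (networks n) (PiE_dflt (dyads n) (False, False) (\<lambda>_. UNIV))"
  unfolding bij_betw_def
proof
  show "inj_on (dyad_config n) (networks n)"
  proof (rule inj_onI, intro ext)
    fix y y' i j
    assume y: "y \<in> networks n" "y' \<in> networks n" and eq: "dyad_config n y = dyad_config n y'"
    have iff: "y i j = 1 \<longleftrightarrow> y' i j = 1"
      using tie_iff_dyad_config[OF y(1)] tie_iff_dyad_config[OF y(2)] by (simp add: eq)
    then show "y i j = y' i j"
      using networks_entry[OF y(1), of i j] networks_entry[OF y(2), of i j] by auto
  qed
  show "dyad_config n ` networks n = PiE_dflt (dyads n) (False, False) (\<lambda>_. UNIV)"
  proof
    show "dyad_config n ` networks n \<subseteq> PiE_dflt (dyads n) (False, False) (\<lambda>_. UNIV)"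
      by (auto simp: PiE_dflt_def dyad_config_def)
    show "PiE_dflt (dyads n) (False, False) (\<lambda>_. UNIV) \<subseteq> dyad_config n ` networks n"
    proof
      fix w :: "nat \<times> nat \<Rightarrow> bool \<times> bool"
      assume w: "w \<in> PiE_dflt (dyads n) (False, False) (\<lambda>_. UNIV)"
      define y where "y i j = (if (i, j) \<in> dyads n then of_bool (fst (w (i, j)))
          else if (j, i) \<in> dyads n then of_bool (snd (w (j, i))) else (0::nat))" for i j
      have "y i j \<in> {0, 1}" for i j by (simp add: y_def)
      moreover have "i \<in> {1..n} \<and> j \<in> {1..n} \<and> i \<noteq> j" if "y i j = 1" for i j :: nat
      proof -
        have "(i, j) \<in> dyads n \<or> (j, i) \<in> dyads n"
          using that by (auto simp: y_def split: if_splits)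
        then show ?thesis by (auto simp: dyads_def)
      qed
      ultimately have "y \<in> networks n"
        unfolding networks_def by blast
      moreover have "dyad_config n y = w"
      proof
        fix d :: "nat \<times> nat"
        obtain i j where d: "d = (i, j)" by force
        have "(j, i) \<notin> dyads n" if "(i, j) \<in> dyads n" using that by (auto simp: dyads_def)
        then show "dyad_config n y d = w d"
          using w by (cases "w d"; cases "(i, j) \<in> dyads n") (auto simp: d dyad_config_def y_def PiE_dflt_def)
      qed
      ultimately show "w \<in> dyad_config n ` networks n" by blast
    qed
  qed
qed

lemma finite_networks: "finite (networks n)"
  unfolding bij_betw_finite[OF bij_betw_dyad_config] by (intro finite_PiE_dflt finite_dyads) simp

text \<open>
  The probability that a dyad is connected. Together with the conditional probability
  \<open>mutual_prob\<close> of being mutual, it reparametrises the cell probabilities of the sparse model so that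
  only one of the two parameters depends on \<open>n\<close>.
\<close>

definition tie_prob :: "nat \<Rightarrow> real \<Rightarrow> real \<Rightarrow> real" where
  "tie_prob n \<alpha> \<beta> = (2 * exp \<alpha> + exp (2 * \<alpha> + \<beta>)) / (real n + 2 * exp \<alpha> + exp (2 * \<alpha> + \<beta>))"

definition mutual_prob :: "real \<Rightarrow> real \<Rightarrow> real" where
  "mutual_prob \<alpha> \<beta> = exp (2 * \<alpha> + \<beta>) / (2 * exp \<alpha> + exp (2 * \<alpha> + \<beta>))"

lemma tie_prob_01: "tie_prob n \<alpha> \<beta> \<in> {0..1}"
  and mutual_prob_01: "0 < mutual_prob \<alpha> \<beta>" "mutual_prob \<alpha> \<beta> < 1"
  by (auto simp: tie_prob_def mutual_prob_def divide_simps add_pos_pos add_nonneg_pos)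

lemma sparse_mass_eq_pmf:
  assumes n: "n \<ge> 1" and y: "y \<in> networks n"
  shows "sparse_mass n \<alpha> \<beta> y =
    pmf (Pi_pmf (dyads n) (False, False) (\<lambda>_. dyad_pmf (tie_prob n \<alpha> \<beta>) (mutual_prob \<alpha> \<beta>))) (dyad_config n y)"
proof -
  define a where "a = exp \<alpha>"
  define b where "b = exp (2 * \<alpha> + \<beta>)"
  have pos: "0 < a" "0 < b" "0 < real n" using n by (auto simp: a_def b_def)
  let ?p = "tie_prob n \<alpha> \<beta>" and ?r = "mutual_prob \<alpha> \<beta>"
  let ?K = "1 + 2 * exp \<alpha> / real n + exp (2 * \<alpha> + \<beta>) / real n"
  have K: "?K = (real n + 2 * a + b) / real n"
    using pos by (simp add: a_def b_def field_simps)
  have cell: "1 / ?K = 1 - ?p" "(a / real n) / ?K = ?p * (1 - ?r) / 2" "(b / real n) / ?K = ?p * ?r"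
    unfolding K tie_prob_def mutual_prob_def a_def[symmetric] b_def[symmetric]
    using pos add_pos_pos[OF pos(1,2)] by (simp_all add: divide_simps)
  have "pmf (Pi_pmf (dyads n) (False, False) (\<lambda>_. dyad_pmf ?p ?r)) (dyad_config n y)
      = (\<Prod>d\<in>dyads n. pmf (dyad_pmf ?p ?r) (dyad_config n y d))"
    by (subst pmf_Pi'[OF finite_dyads]) (auto simp: dyad_config_def)
  also have "\<dots> = sparse_mass n \<alpha> \<beta> y"
    unfolding sparse_mass_eq[OF n]
  proof (rule prod.cong[OF refl], clarify)
    fix i j assume d: "(i, j) \<in> dyads n"
    have e1: "exp (\<alpha> - ln (real n)) = a / real n"
      using pos by (simp add: exp_diff a_def)
    have "(\<alpha> - ln (real n)) * 2 + (\<beta> + ln (real n)) = (2 * \<alpha> + \<beta>) - ln (real n)" by simp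
    then have e2: "exp ((\<alpha> - ln (real n)) * 2 + (\<beta> + ln (real n))) = b / real n"
      using pos by (simp add: exp_diff b_def)
    have "y i j = 0 \<or> y i j = 1" "y j i = 0 \<or> y j i = 1"
      using networks_entry[OF y] by auto
    then show "pmf (dyad_pmf ?p ?r) (dyad_config n y (i, j)) =
        exp ((\<alpha> - ln (real n)) * (real (y i j) + real (y j i)) + (\<beta> + ln (real n)) * real (y i j) * real (y j i)) / ?K"
      using d tie_prob_01[of n \<alpha> \<beta>] mutual_prob_01[of \<alpha> \<beta>] e1 e2 cell
      by (auto simp: dyad_config_def pmf_dyad_pmf)
  qed
  finally show ?thesis ..
qed

definition network_counts :: "nat \<Rightarrow> network \<Rightarrow> nat \<times> nat" where
  "network_counts n y = dyad_counts (dyads n) (dyad_config n y)"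

theorem sparse_model_counts:
  fixes F :: "nat \<times> nat \<Rightarrow> real"
  assumes n: "n \<ge> 1"
  shows "(\<integral>y. F (network_counts n y) \<partial>sparse_model n \<alpha> \<beta>) =
    measure_pmf.expectation (thinned_binomial_pmf (card (dyads n)) (tie_prob n \<alpha> \<beta>) (mutual_prob \<alpha> \<beta>)) F"
proof -
  let ?P = "Pi_pmf (dyads n) (False, False) (\<lambda>_. dyad_pmf (tie_prob n \<alpha> \<beta>) (mutual_prob \<alpha> \<beta>))"
  let ?W = "PiE_dflt (dyads n) (False, False) (\<lambda>_. UNIV :: (bool \<times> bool) set)"
  have nonneg: "0 \<le> sparse_mass n \<alpha> \<beta> y" if "y \<in> networks n" for y
    using sparse_mass_eq_pmf[OF n that] by simp
  have "(\<integral>y. F (network_counts n y) \<partial>sparse_model n \<alpha> \<beta>)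
      = (\<Sum>y\<in>networks n. sparse_mass n \<alpha> \<beta> y * F (network_counts n y))"
    unfolding sparse_model_def
    by (subst lebesgue_integral_point_measure_finite) (auto simp: finite_networks nonneg)
  also have "\<dots> = (\<Sum>y\<in>networks n. pmf ?P (dyad_config n y) * F (dyad_counts (dyads n) (dyad_config n y)))"
    by (rule sum.cong) (simp_all add: sparse_mass_eq_pmf[OF n] network_counts_def)
  also have "\<dots> = (\<Sum>w\<in>?W. pmf ?P w * F (dyad_counts (dyads n) w))"
    by (rule sum.reindex_bij_betw[OF bij_betw_dyad_config])
  also have "\<dots> = measure_pmf.expectation ?P (\<lambda>w. F (dyad_counts (dyads n) w))"
  proof (subst integral_measure_pmf[of ?W])
    show "finite ?W" by (intro finite_PiE_dflt finite_dyads) simp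
    show "w \<in> ?W" if "w \<in> set_pmf ?P" for w
      using that by (auto simp: set_Pi_pmf[OF finite_dyads] PiE_dflt_def)
  qed simp
  also have "\<dots> = measure_pmf.expectation (map_pmf (dyad_counts (dyads n)) ?P) F"
    by simp
  also have "map_pmf (dyad_counts (dyads n)) ?P
      = thinned_binomial_pmf (card (dyads n)) (tie_prob n \<alpha> \<beta>) (mutual_prob \<alpha> \<beta>)"
    using mutual_prob_01[of \<alpha> \<beta>] by (intro map_dyad_counts_Pi_pmf finite_dyads tie_prob_01) auto
  finally show ?thesis .
qed

section \<open>The maximum likelihood estimator in closed form\<close>

text \<open>
  The Gibbs inequality for three cells with counts \<open>a\<close>, \<open>m\<close>, \<open>c\<close> and probabilities proportional to
  \<open>2 * u\<close>, \<open>v\<close>, \<open>1\<close>. In terms of the ratios \<open>x\<close>, \<open>y\<close>, \<open>z\<close> of model probability to observed frequency,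
  the difference of the two sides is \<open>a * ln x + m * ln y + c * ln z\<close>. It is bounded through
  \<open>ln x \<le> x - 1\<close>, which is strict unless \<open>x = 1\<close>.
\<close>

lemma trinomial_log_likelihood_less:
  fixes a m c u v :: real
  assumes pos: "0 < a" "0 < m" "0 < c" "0 < u" "0 < v"
    and ne: "\<not> (u = a / (2 * c) \<and> v = m / c)"
  shows "a * ln u + m * ln v - (a + m + c) * ln (1 + 2 * u + v)
    < a * ln (a / (2 * c)) + m * ln (m / c) - (a + m + c) * ln (1 + 2 * (a / (2 * c)) + m / c)"
proof -
  define N where "N = a + m + c"
  define K where "K = 1 + 2 * u + v"
  define x where "x = 2 * u * N / (a * K)"
  define y where "y = v * N / (m * K)"
  define z where "z = N / (c * K)"
  have NK: "0 < N" "0 < K" using pos by (auto simp: N_def K_def)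
  have xyz: "0 < x" "0 < y" "0 < z" using pos NK by (auto simp: x_def y_def z_def)
  have "a * x + m * y + c * z = N * (1 + 2 * u + v) / K"
    using pos NK by (simp add: x_def y_def z_def field_simps)
  then have sum: "a * x + m * y + c * z = N"
    using NK by (simp add: K_def)
  have KN: "1 + 2 * (a / (2 * c)) + m / c = N / c"
    using pos by (simp add: N_def field_simps)
  have lns: "ln x = ln u - ln (a / (2 * c)) - ln K + ln (N / c)"
    "ln y = ln v - ln (m / c) - ln K + ln (N / c)" "ln z = ln (N / c) - ln K"
    using pos NK by (simp_all add: x_def y_def z_def ln_div ln_mult)
  have diff: "(a * ln u + m * ln v - (a + m + c) * ln (1 + 2 * u + v))
      - (a * ln (a / (2 * c)) + m * ln (m / c) - (a + m + c) * ln (1 + 2 * (a / (2 * c)) + m / c))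
      = a * ln x + m * ln y + c * ln z"
    unfolding K_def[symmetric] KN lns by (simp add: algebra_simps)
  have le: "a * ln x \<le> a * (x - 1)" "m * ln y \<le> m * (y - 1)" "c * ln z \<le> c * (z - 1)"
    using pos xyz by (intro mult_left_mono ln_le_minus_one; simp)+
  have "\<not> (x = 1 \<and> y = 1 \<and> z = 1)"
  proof
    assume "x = 1 \<and> y = 1 \<and> z = 1"
    then have "N = c * K" "2 * u * N = a * K" "v * N = m * K"
      using pos NK by (auto simp: x_def y_def z_def field_simps)
    then have "2 * u * c * K = a * K" "v * c * K = m * K" by (auto simp: mult_ac)
    then have "2 * u * c = a" "v * c = m" using NK by auto
    then show False using ne pos by (auto simp: field_simps)
  qed
  then have "a * ln x < a * (x - 1) \<or> m * ln y < m * (y - 1) \<or> c * ln z < c * (z - 1)"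
    using pos xyz le ln_eq_minus_one by (metis less_eq_real_def mult_cancel_left order_less_irrefl)
  then have "a * ln x + m * ln y + c * ln z < a * (x - 1) + m * (y - 1) + c * (z - 1)"
    using le by linarith
  also have "\<dots> = 0" using sum by (simp add: N_def algebra_simps)
  finally show ?thesis using diff by linarith
qed

text \<open>
  The exponent sums over the dyads the number of ties, which is 1 for each connected dyad plus 1 more
  for each mutual dyad, and the number of mutual dyads.
\<close>

lemma sparse_mass_counts:
  assumes n: "n \<ge> 1" and y: "y \<in> networks n" and tm: "network_counts n y = (t, m)"
  shows "sparse_mass n \<alpha> \<beta> y = exp ((\<alpha> - ln (real n)) * (real t + real m) + (\<beta> + ln (real n)) * real m)
    / (1 + 2 * exp (\<alpha> - ln (real n)) + exp (2 * (\<alpha> - ln (real n)) + (\<beta> + ln (real n)))) ^ card (dyads n)"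
proof -
  let ?c = "dyad_config n y"
  have sum_of_bool: "(\<Sum>d\<in>dyads n. of_bool (P d)) = real (card {d \<in> dyads n. P d})" for P
    using finite_dyads by (simp add: Int_def conj_commute)
  have t: "(\<Sum>d\<in>dyads n. of_bool (?c d \<noteq> (False, False))) = real t"
    and m: "(\<Sum>d\<in>dyads n. of_bool (?c d = (True, True))) = real m"
    using tm unfolding network_counts_def dyad_counts_def sum_of_bool by auto
  have entry: "real (y i j) + real (y j i) = of_bool (?c (i, j) \<noteq> (False, False)) + of_bool (?c (i, j) = (True, True))"
    "real (y i j) * real (y j i) = of_bool (?c (i, j) = (True, True))" if "(i, j) \<in> dyads n" for i j
    using networks_entry[OF y, of i j] networks_entry[OF y, of j i] that by (auto simp: dyad_config_def)
  define a where "a = \<alpha> - ln (real n)"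
  define b where "b = \<beta> + ln (real n)"
  have "sparse_mass n \<alpha> \<beta> y = (\<Prod>d\<in>dyads n. exp (a * (of_bool (?c d \<noteq> (False, False)) + of_bool (?c d = (True, True)))
      + b * of_bool (?c d = (True, True))) / (1 + 2 * exp a + exp (2 * a + b)))"
    unfolding sparse_mass_def bernoulli_mass_def a_def[symmetric] b_def[symmetric]
    by (rule prod.cong[OF refl], clarify) (simp only: mult.assoc entry)
  also have "\<dots> = exp (\<Sum>d\<in>dyads n. a * (of_bool (?c d \<noteq> (False, False)) + of_bool (?c d = (True, True)))
      + b * of_bool (?c d = (True, True))) / (1 + 2 * exp a + exp (2 * a + b)) ^ card (dyads n)"
    by (simp add: prod_dividef exp_sum finite_dyads)
  also have "(\<Sum>d\<in>dyads n. a * (of_bool (?c d \<noteq> (False, False)) + of_bool (?c d = (True, True)))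
      + b * of_bool (?c d = (True, True))) = a * (real t + real m) + b * real m"
    by (simp only: sum.distrib sum_distrib_left[symmetric] t m)
  finally show ?thesis unfolding a_def b_def .
qed

text \<open>
  Exactly one parameter \<open>(a, b)\<close> reproduces the observed ratios \<open>u\<close> and \<open>v\<close> of the dyad types, and every
  other parameter has a strictly smaller likelihood. A maximizer therefore exists and is unique, so
  that the estimator has to take this value.
\<close>

lemma sparse_mle_eq:
  assumes mle: "is_sparse_mle n ahat bhat" and n: "n \<ge> 1" and y: "y \<in> networks n"
    and tm: "network_counts n y = (t, m)" and pos: "0 < m" "m < t" "t < card (dyads n)"
  defines "e \<equiv> real (card (dyads n)) - real t"
  shows "ahat y = ln (real n * (real t - real m) / (2 * e))"
    and "2 * ahat y + bhat y = ln (real n * real m / e)"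
proof -
  define u where "u = (real t - real m) / (2 * e)"
  define v where "v = real m / e"
  have pos': "0 < real t - real m" "0 < real m" "0 < e" "0 < real n"
    using pos n by (auto simp: e_def)
  have uv: "0 < u" "0 < v" using pos' by (auto simp: u_def v_def)
  have ln_mass: "ln (sparse_mass n \<alpha> \<beta> y) =
      (real t - real m) * ln (exp (\<alpha> - ln n)) + real m * ln (exp (2 * (\<alpha> - ln n) + (\<beta> + ln n)))
      - ((real t - real m) + real m + e) * ln (1 + 2 * exp (\<alpha> - ln n) + exp (2 * (\<alpha> - ln n) + (\<beta> + ln n)))" for \<alpha> \<beta>
  proof -
    define K where "K = 1 + 2 * exp (\<alpha> - ln n) + exp (2 * (\<alpha> - ln n) + (\<beta> + ln n))"
    have "0 < K" by (simp add: K_def add_pos_pos)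
    then show ?thesis
      unfolding sparse_mass_counts[OF n y tm] K_def[symmetric] ln_exp
      by (simp add: ln_div ln_realpow e_def algebra_simps)
  qed
  have mass_pos: "0 < sparse_mass n \<alpha> \<beta> y" for \<alpha> \<beta>
    unfolding sparse_mass_counts[OF n y tm] by (simp add: add_pos_pos)
  define a where "a = ln u + ln n"
  define b where "b = ln v - 2 * ln u - ln n"
  have ab: "exp (a - ln n) = u" "exp (2 * (a - ln n) + (b + ln n)) = v"
    using uv by (auto simp: a_def b_def)
  have less: "sparse_mass n \<alpha> \<beta> y < sparse_mass n a b y"
    if "\<not> (exp (\<alpha> - ln n) = u \<and> exp (2 * (\<alpha> - ln n) + (\<beta> + ln n)) = v)" for \<alpha> \<beta>
  proof -
    have "ln (sparse_mass n \<alpha> \<beta> y) < ln (sparse_mass n a b y)"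
      unfolding ln_mass ab
      using trinomial_log_likelihood_less[OF pos'(1-3), of "exp (\<alpha> - ln n)" "exp (2 * (\<alpha> - ln n) + (\<beta> + ln n))"] that
      by (simp add: u_def v_def)
    then show ?thesis using mass_pos by simp
  qed
  have eq: "sparse_mass n \<alpha> \<beta> y = sparse_mass n a b y"
    if "exp (\<alpha> - ln n) = u" "exp (2 * (\<alpha> - ln n) + (\<beta> + ln n)) = v" for \<alpha> \<beta>
  proof -
    have "ln (sparse_mass n \<alpha> \<beta> y) = ln (sparse_mass n a b y)"
      unfolding ln_mass that ab ..
    then show ?thesis
      using mass_pos by (simp add: ln_inj_iff)
  qed
  have "sparse_likelihood_maximizer n y a b"
  proof -
    have "\<not> sparse_mass n a b y < sparse_mass n \<alpha> \<beta> y" for \<alpha> \<beta>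
      using less[of \<alpha> \<beta>] eq[of \<alpha> \<beta>] by fastforce
    then show ?thesis
      unfolding sparse_likelihood_maximizer_def is_arg_max_def by auto
  qed
  then have "sparse_likelihood_maximizer n y (ahat y) (bhat y)"
    using mle y unfolding is_sparse_mle_def by blast
  then have "\<not> sparse_mass n (ahat y) (bhat y) y < sparse_mass n a b y"
    unfolding sparse_likelihood_maximizer_def is_arg_max_def by auto
  then have "exp (ahat y - ln n) = u" "exp (2 * (ahat y - ln n) + (bhat y + ln n)) = v"
    using less by blast+
  then have "ahat y - ln n = ln u" "2 * (ahat y - ln n) + (bhat y + ln n) = ln v"
    by (metis ln_exp)+
  moreover have "ln (real n * (real t - real m) / (2 * e)) = ln n + ln u" "ln (real n * real m / e) = ln n + ln v"
    using pos' by (simp_all add: u_def v_def ln_mult ln_div)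
  ultimately show "ahat y = ln (real n * (real t - real m) / (2 * e))"
    and "2 * ahat y + bhat y = ln (real n * real m / e)"
    by (simp_all add: algebra_simps)
qed

section \<open>The delta method along deterministic count sequences\<close>

text \<open>
  The difference quotient of the logarithm at \<open>c\<close> extends continuously by its derivative there.
\<close>

lemma sqrt_ln_delta:
  fixes x :: "nat \<Rightarrow> real"
  assumes c: "0 < c" and dev: "(\<lambda>n. sqrt (real n) * (x n - c)) \<longlonglongrightarrow> d"
  shows "x \<longlonglongrightarrow> c" and "(\<lambda>n. sqrt (real n) * (ln (x n) - ln c)) \<longlonglongrightarrow> d / c"
proof -
  have "(\<lambda>n. 1 / sqrt (real n)) \<longlonglongrightarrow> 0"
    by real_asymp
  from tendsto_add[OF tendsto_mult[OF dev this] tendsto_const[of c]]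
  have "(\<lambda>n. sqrt (real n) * (x n - c) * (1 / sqrt (real n)) + c) \<longlonglongrightarrow> c"
    by simp
  moreover have "\<forall>\<^sub>F n in sequentially. sqrt (real n) * (x n - c) * (1 / sqrt (real n)) + c = x n"
    using eventually_gt_at_top[of 0] by eventually_elim simp
  ultimately show x: "x \<longlonglongrightarrow> c"
    using tendsto_cong by fast
  obtain g where g: "\<And>z. ln z - ln c = g z * (z - c)" "isCont g c" "g c = inverse c"
    using DERIV_ln[OF c] unfolding CARAT_DERIV by auto
  have "(\<lambda>n. g (x n)) \<longlonglongrightarrow> inverse c"
    using isCont_tendsto_compose[OF g(2) x] g(3) by simp
  from tendsto_mult[OF dev this]
  show "(\<lambda>n. sqrt (real n) * (ln (x n) - ln c)) \<longlonglongrightarrow> d / c"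
    by (simp add: g(1) divide_inverse mult_ac)
qed

lemma divide_sqrt_eq: "0 < x \<Longrightarrow> z / sqrt x = sqrt x * (z / x)" for x z :: real
  by (simp add: divide_simps)

text \<open>
  The three quantities tend to the intensities of asymmetric and of mutual dyads per vertex and to 1,
  the limiting frequency of empty dyads. The last one has no fluctuation on this scale: it deviates
  from 1 by \<open>O(1 / n)\<close>, since only \<open>O(n)\<close> of about \<open>n\<^sup>2 / 2\<close> dyads are connected.
\<close>

lemma sparse_count_deviations:
  fixes t m :: "nat \<Rightarrow> real" and l r :: real
  assumes l: "0 < l" and r: "0 < r" "r < 1"
    and N: "\<And>n. N n = real n * (real n - 1) / 2" and p: "\<And>n. p n = 2 * l / (real n + 2 * l)"
    and dev_t: "(\<lambda>n. (t n - N n * p n) / sqrt (l * real n)) \<longlonglongrightarrow> x"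
    and dev_m: "(\<lambda>n. (m n - t n * r) / sqrt (l * r * (1 - r) * real n)) \<longlonglongrightarrow> y"
  defines "s \<equiv> sqrt (l * r * (1 - r))"
  shows "(\<lambda>n. sqrt (real n) * ((t n - m n) / real n - l * (1 - r))) \<longlonglongrightarrow> (1 - r) * sqrt l * x - s * y"
    and "(\<lambda>n. sqrt (real n) * (m n / real n - l * r)) \<longlonglongrightarrow> r * sqrt l * x + s * y"
    and "(\<lambda>n. sqrt (real n) * (2 * (N n - t n) / (real n)\<^sup>2 - 1)) \<longlonglongrightarrow> 0"
proof -
  have s: "0 < s" using l r by (simp add: s_def)
  have "(\<lambda>n. sqrt (real n) * ((real n - 1) * l / (real n + 2 * l) - l)) \<longlonglongrightarrow> 0"
    using l by real_asymp
  from tendsto_add[OF tendsto_mult[OF tendsto_const[of "sqrt l"] dev_t] this]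
  have "(\<lambda>n. sqrt l * ((t n - N n * p n) / sqrt (l * real n)) +
      sqrt (real n) * ((real n - 1) * l / (real n + 2 * l) - l)) \<longlonglongrightarrow> sqrt l * x"
    by simp
  moreover have "\<forall>\<^sub>F n in sequentially. sqrt l * ((t n - N n * p n) / sqrt (l * real n)) +
      sqrt (real n) * ((real n - 1) * l / (real n + 2 * l) - l) = sqrt (real n) * (t n / real n - l)"
    using eventually_gt_at_top[of 0]
  proof eventually_elim
    case (elim n)
    then have n: "0 < real n" by auto
    have "sqrt l * ((t n - N n * p n) / sqrt (l * real n)) = (t n - N n * p n) / sqrt (real n)"
      using l by (simp add: real_sqrt_mult)
    also have "\<dots> = sqrt (real n) * ((t n - N n * p n) / real n)"
      by (rule divide_sqrt_eq) (use n in simp)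
    also have "(t n - N n * p n) / real n = t n / real n - (real n - 1) * l / (real n + 2 * l)"
      using n by (simp add: N p diff_divide_distrib)
    finally show ?case by (simp add: algebra_simps)
  qed
  ultimately have T: "(\<lambda>n. sqrt (real n) * (t n / real n - l)) \<longlonglongrightarrow> sqrt l * x"
    by (rule Lim_transform_eventually)
  from tendsto_add[OF tendsto_mult[OF tendsto_const[of r] T] tendsto_mult[OF tendsto_const[of s] dev_m]]
  have "(\<lambda>n. r * (sqrt (real n) * (t n / real n - l)) + s * ((m n - t n * r) / sqrt (l * r * (1 - r) * real n)))
    \<longlonglongrightarrow> r * sqrt l * x + s * y"
    by (simp add: mult.assoc)
  moreover have "\<forall>\<^sub>F n in sequentially. r * (sqrt (real n) * (t n / real n - l)) + s * ((m n - t n * r) / sqrt (l * r * (1 - r) * real n))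
      = sqrt (real n) * (m n / real n - l * r)"
    using eventually_gt_at_top[of 0]
  proof eventually_elim
    case (elim n)
    then have n: "0 < real n" by auto
    have "s * ((m n - t n * r) / sqrt (l * r * (1 - r) * real n)) = (m n - t n * r) / sqrt (real n)"
      using s by (simp add: real_sqrt_mult[of "l * r * (1 - r)"] flip: s_def)
    also have "\<dots> = sqrt (real n) * ((m n - t n * r) / real n)"
      by (rule divide_sqrt_eq) (use n in simp)
    finally show ?case by (simp add: algebra_simps diff_divide_distrib)
  qed
  ultimately show M: "(\<lambda>n. sqrt (real n) * (m n / real n - l * r)) \<longlonglongrightarrow> r * sqrt l * x + s * y"
    by (rule Lim_transform_eventually)
  from tendsto_diff[OF T M]
  show "(\<lambda>n. sqrt (real n) * ((t n - m n) / real n - l * (1 - r))) \<longlonglongrightarrow> (1 - r) * sqrt l * x - s * y"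
    by (simp add: algebra_simps diff_divide_distrib)
  have "(\<lambda>n. 2 / real n * (sqrt (real n) * (t n / real n - l)) + (1 + 2 * l) / sqrt (real n)) \<longlonglongrightarrow> 0 * (sqrt l * x) + 0"
    by (intro tendsto_add tendsto_mult T; real_asymp)
  moreover have "\<forall>\<^sub>F n in sequentially. 2 / real n * (sqrt (real n) * (t n / real n - l)) + (1 + 2 * l) / sqrt (real n)
     = - (sqrt (real n) * (2 * (N n - t n) / (real n)\<^sup>2 - 1))"
    using eventually_gt_at_top[of 0]
  proof eventually_elim
    case (elim n)
    define q where "q = sqrt (real n)"
    have q: "0 < q" "real n = q\<^sup>2" using elim by (auto simp: q_def)
    show ?case
      unfolding N q_def[symmetric] q(2) using q(1) by (simp add: field_simps power2_eq_square)
  qed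
  ultimately have "(\<lambda>n. - (sqrt (real n) * (2 * (N n - t n) / (real n)\<^sup>2 - 1))) \<longlonglongrightarrow> 0"
    using Lim_transform_eventually by fastforce
  then show "(\<lambda>n. sqrt (real n) * (2 * (N n - t n) / (real n)\<^sup>2 - 1)) \<longlonglongrightarrow> 0"
    using tendsto_minus by fastforce
qed

text \<open>
  The limiting number of connected dyads per vertex.
\<close>

definition limit_count :: "real \<Rightarrow> real \<Rightarrow> real" where
  "limit_count \<alpha> \<beta> = exp \<alpha> + exp (2 * \<alpha> + \<beta>) / 2"

text \<open>
  Relevant only where \<open>all_dyad_types\<close> holds: elsewhere a logarithm is taken of a number that is not
  positive or of a quotient by 0, and the value has no meaning.
\<close>

definition closed_form_mle :: "nat \<Rightarrow> nat \<times> nat \<Rightarrow> real ^ 2" where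
  "closed_form_mle n = (\<lambda>(t, m).
     let e = real (card (dyads n)) - real t; a = ln (real n * (real t - real m) / (2 * e))
     in vector [a, ln (real n * real m / e) - 2 * a])"

definition all_dyad_types :: "nat \<Rightarrow> nat \<times> nat \<Rightarrow> bool" where
  "all_dyad_types n = (\<lambda>(t, m). 0 < m \<and> m < t \<and> t < card (dyads n))"

text \<open>
  The linearization of the closed form estimator at the limiting counts. The first column belongs to
  the fluctuation of the number of connected dyads, the second one to that of the number of mutual
  dyads among them, each measured in units of its standard deviation.
\<close>

definition limit_matrix :: "real \<Rightarrow> real \<Rightarrow> real ^ 2 ^ 2" where
  "limit_matrix \<alpha> \<beta> =
    (let l = limit_count \<alpha> \<beta>; r = mutual_prob \<alpha> \<beta>; s = sqrt (l * r * (1 - r))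
     in vector [vector [1 / sqrt l, - s / exp \<alpha>],
                vector [- 1 / sqrt l, 2 * s / exp \<alpha> + 2 * s / exp (2 * \<alpha> + \<beta>)]])"

lemma limit_count_pos: "0 < limit_count \<alpha> \<beta>"
  by (simp add: limit_count_def add_pos_pos)

lemma limit_count_times_mutual_prob:
  "limit_count \<alpha> \<beta> * mutual_prob \<alpha> \<beta> = exp (2 * \<alpha> + \<beta>) / 2"
  "limit_count \<alpha> \<beta> * (1 - mutual_prob \<alpha> \<beta>) = exp \<alpha>"
proof -
  have "2 * limit_count \<alpha> \<beta> = 2 * exp \<alpha> + exp (2 * \<alpha> + \<beta>)"
    by (simp add: limit_count_def)
  then have r: "mutual_prob \<alpha> \<beta> = exp (2 * \<alpha> + \<beta>) / (2 * limit_count \<alpha> \<beta>)"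
    by (simp add: mutual_prob_def)
  then show 1: "limit_count \<alpha> \<beta> * mutual_prob \<alpha> \<beta> = exp (2 * \<alpha> + \<beta>) / 2"
    using limit_count_pos[of \<alpha> \<beta>] by simp
  show "limit_count \<alpha> \<beta> * (1 - mutual_prob \<alpha> \<beta>) = exp \<alpha>"
    using 1 by (simp add: right_diff_distrib) (simp add: limit_count_def)
qed

text \<open>
  After the factors of \<open>n\<close> are distributed, the estimators of \<open>\<alpha>\<close> and of \<open>2 * \<alpha> + \<beta>\<close> are, up to a
  constant, differences of logarithms of the three normalized counts, and the delta method applies to
  each logarithm.
\<close>

lemma closed_form_mle_limit:
  fixes t m :: "nat \<Rightarrow> nat" and \<alpha> \<beta> :: real
  defines "l \<equiv> limit_count \<alpha> \<beta>" and "r \<equiv> mutual_prob \<alpha> \<beta>"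
  assumes dev_t: "(\<lambda>n. (real (t n) - real (card (dyads n)) * tie_prob n \<alpha> \<beta>) / sqrt (l * real n)) \<longlonglongrightarrow> x"
    and dev_m: "(\<lambda>n. (real (m n) - real (t n) * r) / sqrt (l * r * (1 - r) * real n)) \<longlonglongrightarrow> y"
  shows "\<forall>\<^sub>F n in sequentially. all_dyad_types n (t n, m n)"
    and "(\<lambda>n. sqrt (real n) *\<^sub>R (closed_form_mle n (t n, m n) - vector [\<alpha>, \<beta>]))
      \<longlonglongrightarrow> limit_matrix \<alpha> \<beta> *v vector [x, y]"
proof -
  define a b s where "a = exp \<alpha>" and "b = exp (2 * \<alpha> + \<beta>)" and "s = sqrt (l * r * (1 - r))"
  define tm where "tm n = (real (t n) - real (m n)) / real n" for n
  define mn where "mn n = real (m n) / real n" for n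
  define en where "en n = 2 * (real (card (dyads n)) - real (t n)) / (real n)\<^sup>2" for n
  have l: "0 < l" by (simp add: l_def limit_count_pos)
  have r: "0 < r" "r < 1" by (simp_all add: r_def mutual_prob_01)
  have ab: "0 < a" "0 < b" by (simp_all add: a_def b_def)
  have lr: "l * r = b / 2" "l * (1 - r) = a"
    by (simp_all add: l_def r_def a_def b_def limit_count_times_mutual_prob)
  have p: "tie_prob n \<alpha> \<beta> = 2 * l / (real n + 2 * l)" for n
    by (simp add: tie_prob_def l_def limit_count_def add.assoc)
  note dev = sparse_count_deviations[OF l r card_dyads p dev_t dev_m, folded s_def]
  note tm = sqrt_ln_delta[OF ab(1) dev(1)[unfolded lr(2), folded tm_def]]
  have b2: "0 < b / 2" using ab by simp
  note mn = sqrt_ln_delta[OF b2 dev(2)[unfolded lr(1), folded mn_def]]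
  note en = sqrt_ln_delta[OF zero_less_one dev(3)[folded en_def]]
  have pos: "\<forall>\<^sub>F n in sequentially. 0 < tm n \<and> 0 < mn n \<and> 0 < en n \<and> 0 < n"
    using order_tendstoD(1)[OF tm(1) ab(1)] order_tendstoD(1)[OF mn(1) b2]
      order_tendstoD(1)[OF en(1) zero_less_one] eventually_gt_at_top[of "0::nat"]
    by eventually_elim simp
  then show "\<forall>\<^sub>F n in sequentially. all_dyad_types n (t n, m n)"
    by eventually_elim (simp add: all_dyad_types_def tm_def mn_def en_def zero_less_divide_iff zero_less_mult_iff)
  have lim1: "(\<lambda>n. sqrt (real n) * (ln (tm n) - ln a) - sqrt (real n) * (ln (en n) - ln 1))
      \<longlonglongrightarrow> ((1 - r) * sqrt l * x - s * y) / a - 0 / 1"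
    by (intro tendsto_diff tm en)
  have lim2: "(\<lambda>n. sqrt (real n) * (ln (mn n) - ln (b / 2)) - sqrt (real n) * (ln (en n) - ln 1))
      \<longlonglongrightarrow> (r * sqrt l * x + s * y) / (b / 2) - 0 / 1"
    by (intro tendsto_diff mn en)
  have comp: "\<forall>\<^sub>F n in sequentially.
      ln (real n * (real (t n) - real (m n)) / (2 * (real (card (dyads n)) - real (t n)))) = ln (tm n) - ln (en n) \<and>
      ln (real n * real (m n) / (real (card (dyads n)) - real (t n))) = ln 2 + ln (mn n) - ln (en n)"
    using pos
  proof eventually_elim
    case (elim n)
    define D E where "D = real (t n) - real (m n)" and "E = real (card (dyads n)) - real (t n)"
    have "E \<noteq> 0" "0 < real n"
      using elim by (auto simp: en_def E_def)
    then have eqs: "real n * (real (t n) - real (m n)) / (2 * (real (card (dyads n)) - real (t n))) = tm n / en n"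
      "real n * real (m n) / (real (card (dyads n)) - real (t n)) = 2 * mn n / en n"
      unfolding tm_def mn_def en_def D_def[symmetric] E_def[symmetric]
      by (simp_all add: power2_eq_square)
    show ?case
      unfolding eqs using elim by (simp add: ln_div ln_mult)
  qed
  have sl: "sqrt l * (sqrt l * z) = l * z" for z using l by (simp add: mult.assoc[symmetric])
  have c1: "((1 - r) * sqrt l * x - s * y) / a - 0 / 1 = x / sqrt l - s / a * y"
  proof -
    have "(1 - r) * sqrt l / a = 1 / sqrt l"
      using ab l by (simp add: divide_simps mult_ac sl lr)
    then have "(1 - r) * sqrt l / a * x = 1 / sqrt l * x" by (rule arg_cong)
    then have "(1 - r) * sqrt l * x / a = x / sqrt l" by simp
    then show ?thesis by (simp add: diff_divide_distrib)
  qed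
  have c2: "(r * sqrt l * x + s * y) / (b / 2) - 0 / 1 = x / sqrt l + 2 * s / b * y"
  proof -
    have "r * sqrt l / (b / 2) = 1 / sqrt l"
      using ab l lr(1) by (simp add: divide_simps mult_ac sl)
    then have "r * sqrt l / (b / 2) * x = 1 / sqrt l * x" by (rule arg_cong)
    then have "r * sqrt l * x / (b / 2) = x / sqrt l" by (simp add: mult_ac)
    then show ?thesis by (simp add: add_divide_distrib)
  qed
  have ln_ab: "ln a = \<alpha>" "ln (b / 2) = 2 * \<alpha> + \<beta> - ln 2"
    using ab by (simp_all add: ln_div) (simp_all add: a_def b_def)
  have mat: "limit_matrix \<alpha> \<beta> *v vector [x, y]
      = vector [x / sqrt l - s / a * y, (x / sqrt l + 2 * s / b * y) - 2 * (x / sqrt l - s / a * y)]"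
    unfolding limit_matrix_def Let_def l_def[symmetric] r_def[symmetric] a_def[symmetric] b_def[symmetric] s_def[symmetric]
    by (simp add: vec_eq_iff forall_2 matrix_vector_mult_def sum_2 algebra_simps)
  show "(\<lambda>n. sqrt (real n) *\<^sub>R (closed_form_mle n (t n, m n) - vector [\<alpha>, \<beta>]))
      \<longlonglongrightarrow> limit_matrix \<alpha> \<beta> *v vector [x, y]"
  proof (rule Lim_transform_eventually)
    let ?A = "\<lambda>n. sqrt (real n) * (ln (tm n) - ln a) - sqrt (real n) * (ln (en n) - ln 1)"
    let ?B = "\<lambda>n. sqrt (real n) * (ln (mn n) - ln (b / 2)) - sqrt (real n) * (ln (en n) - ln 1)"
    show "(\<lambda>n. vector [?A n, ?B n - 2 * ?A n] :: real ^ 2) \<longlonglongrightarrow> limit_matrix \<alpha> \<beta> *v vector [x, y]"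
    proof (rule vec_tendstoI)
      fix i :: 2
      have A: "?A \<longlonglongrightarrow> x / sqrt l - s / a * y" and B: "?B \<longlonglongrightarrow> x / sqrt l + 2 * s / b * y"
        using lim1 lim2 unfolding c1 c2 .
      from exhaust_2[of i]
      show "(\<lambda>n. (vector [?A n, ?B n - 2 * ?A n] :: real ^ 2) $ i) \<longlonglongrightarrow> (limit_matrix \<alpha> \<beta> *v vector [x, y]) $ i"
      proof
        assume "i = 1"
        then show ?thesis using A by (simp only: mat vector_2)
      next
        assume "i = 2"
        then show ?thesis
          using tendsto_diff[OF B tendsto_mult_left[OF A, of 2]] by (simp only: mat vector_2)
      qed
    qed
    show "\<forall>\<^sub>F n in sequentially. vector [?A n, ?B n - 2 * ?A n]
        = sqrt (real n) *\<^sub>R (closed_form_mle n (t n, m n) - vector [\<alpha>, \<beta>])"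
      using comp
    proof eventually_elim
      case (elim n)
      show ?case
        unfolding closed_form_mle_def prod.case Let_def elim[THEN conjunct1] elim[THEN conjunct2] ln_ab
        by (simp add: vec_eq_iff forall_2 algebra_simps)
    qed
  qed
qed

text \<open>
  Everything is expressed by \<open>a = exp \<alpha>\<close> and \<open>b = exp (2 * \<alpha> + \<beta>)\<close>, because \<open>l = a + b / 2\<close> and
  \<open>s\<^sup>2 = a * b / (2 * l)\<close>.
\<close>

lemma limit_matrix_covariance:
  "limit_matrix \<alpha> \<beta> ** transpose (limit_matrix \<alpha> \<beta>) =
    exp (- \<alpha>) *\<^sub>R vector [vector [1, - 2], vector [- 2, 4 + 2 * exp (- \<alpha> - \<beta>)]]"
  and det_limit_matrix: "det (limit_matrix \<alpha> \<beta>) \<noteq> 0"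
proof -
  define a b l r where "a = exp \<alpha>" and "b = exp (2 * \<alpha> + \<beta>)" and "l = limit_count \<alpha> \<beta>" and "r = mutual_prob \<alpha> \<beta>"
  define s where "s = sqrt (l * r * (1 - r))"
  have l: "0 < l" by (simp add: l_def limit_count_pos)
  have r: "0 < r" "r < 1" by (simp_all add: r_def mutual_prob_01)
  have ab: "0 < a" "0 < b" by (simp_all add: a_def b_def)
  have lr: "l * r = b / 2" "l * (1 - r) = a"
    by (simp_all add: l_def r_def a_def b_def limit_count_times_mutual_prob)
  have l_eq: "l = a + b / 2" by (simp add: l_def limit_count_def a_def b_def)
  have "l * (l * r * (1 - r)) = (l * r) * (l * (1 - r))" by (simp add: mult_ac)
  then have "l * r * (1 - r) = a * b / (2 * l)"
    using l unfolding lr by (simp add: field_simps)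
  moreover have "s * s = l * r * (1 - r)" and s: "0 < s" using l r by (auto simp: s_def)
  ultimately have ss: "s * s = a * b / (2 * l)" by simp
  have L: "limit_matrix \<alpha> \<beta> = vector [vector [1 / sqrt l, - s / a], vector [- 1 / sqrt l, 2 * s / a + 2 * s / b]]"
    by (simp add: limit_matrix_def Let_def a_def b_def l_def r_def s_def)
  show "det (limit_matrix \<alpha> \<beta>) \<noteq> 0"
  proof -
    have "det (limit_matrix \<alpha> \<beta>) = s / sqrt l * (1 / a + 2 / b)"
      unfolding L det_2 by (simp add: algebra_simps add_divide_distrib)
    moreover have "0 < s / sqrt l * (1 / a + 2 / b)"
      using l s ab by (intro mult_pos_pos add_pos_pos divide_pos_pos) auto
    ultimately show ?thesis by linarith
  qed
  have e: "exp (- \<alpha>) = 1 / a" "exp (- \<alpha> - \<beta>) = a / b"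
  proof -
    show "exp (- \<alpha>) = 1 / a" by (simp add: a_def exp_minus divide_inverse)
    have "\<alpha> - (2 * \<alpha> + \<beta>) = - \<alpha> - \<beta>" by simp
    then show "exp (- \<alpha> - \<beta>) = a / b" unfolding a_def b_def by (metis exp_diff)
  qed
  define q w z where "q = 1 / sqrt l" and "w = s / a" and "z = 2 * s / a + 2 * s / b"
  have qq: "q * q = 1 / l" using l by (simp add: q_def)
  have ww: "w * w = (s * s) / (a * a)" by (simp add: w_def)
  have wz: "w * z = (s * s) * (2 / a + 2 / b) / a"
    by (simp add: w_def z_def algebra_simps add_divide_distrib)
  have zz: "z * z = (s * s) * ((2 / a + 2 / b) * (2 / a + 2 / b))"
    by (simp add: z_def algebra_simps add_divide_distrib)
  have 11: "q * q + w * w = 1 / a"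
    unfolding qq ww ss l_eq using ab by (simp add: divide_simps) (simp add: algebra_simps)
  have 12: "q * q + w * z = 2 / a"
    unfolding qq wz ss l_eq using ab by (simp add: divide_simps) (simp add: algebra_simps)
  have 22: "q * q + z * z = (4 + 2 * (a / b)) / a"
    unfolding qq zz ss l_eq using ab by (simp add: divide_simps) (simp add: algebra_simps)
  have "limit_matrix \<alpha> \<beta> = vector [vector [q, - w], vector [- q, z]]"
    by (simp add: L q_def w_def z_def)
  then show "limit_matrix \<alpha> \<beta> ** transpose (limit_matrix \<alpha> \<beta>) =
    exp (- \<alpha>) *\<^sub>R vector [vector [1, - 2], vector [- 2, 4 + 2 * exp (- \<alpha> - \<beta>)]]"
    unfolding e using 11 12 22
    by (simp add: vec_eq_iff forall_2 matrix_matrix_mult_def transpose_def sum_2 mult.commute)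
qed

section \<open>Asymptotic normality of the estimator\<close>

theorem sparse_model_continuous_mapping:
  fixes F :: "nat \<Rightarrow> nat \<times> nat \<Rightarrow> real" and \<alpha> \<beta> :: real
  defines "l \<equiv> limit_count \<alpha> \<beta>" and "r \<equiv> mutual_prob \<alpha> \<beta>"
  assumes bdd: "\<And>n x. \<bar>F n x\<bar> \<le> B"
    and conv: "\<And>t m x y.
      (\<lambda>n. (real (t n) - real (card (dyads n)) * tie_prob n \<alpha> \<beta>) / sqrt (l * real n)) \<longlonglongrightarrow> x \<Longrightarrow>
      (\<lambda>n. (real (m n) - real (t n) * r) / sqrt (l * r * (1 - r) * real n)) \<longlonglongrightarrow> y \<Longrightarrow>
      (\<lambda>n. F n (t n, m n)) \<longlonglongrightarrow> G (x, y)"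
    and meas: "G \<in> borel_measurable (borel \<Otimes>\<^sub>M borel)"
  shows "(\<lambda>n. \<integral>y. F n (network_counts n y) \<partial>sparse_model n \<alpha> \<beta>)
    \<longlonglongrightarrow> (\<integral>x. \<integral>y. G (x, y) \<partial>std_normal_distribution \<partial>std_normal_distribution)"
proof (rule Lim_transform_eventually)
  have l: "0 < l" by (simp add: l_def limit_count_pos)
  have p: "tie_prob n \<alpha> \<beta> = 2 * l / (real n + 2 * l)" for n
    by (simp add: tie_prob_def l_def limit_count_def add.assoc)
  have "(\<lambda>n. (real n - 1) * l / (real n + 2 * l)) \<longlonglongrightarrow> l"
    using l by real_asymp
  moreover have "\<forall>\<^sub>F n in sequentially. (real n - 1) * l / (real n + 2 * l) = real (card (dyads n)) * tie_prob n \<alpha> \<beta> / real n"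
    using eventually_gt_at_top[of 0] by eventually_elim (simp add: card_dyads p)
  ultimately have mean: "(\<lambda>n. real (card (dyads n)) * tie_prob n \<alpha> \<beta> / real n) \<longlonglongrightarrow> l"
    by (rule Lim_transform_eventually)
  have p0: "(\<lambda>n. tie_prob n \<alpha> \<beta>) \<longlonglongrightarrow> 0"
    unfolding p by real_asymp
  show "(\<lambda>n. measure_pmf.expectation (thinned_binomial_pmf (card (dyads n)) (tie_prob n \<alpha> \<beta>) r) (F n))
    \<longlonglongrightarrow> (\<integral>x. \<integral>y. G (x, y) \<partial>std_normal_distribution \<partial>std_normal_distribution)"
    by (rule thinned_binomial_continuous_mapping[where l = l and B = B])
       (use l mean p0 bdd conv meas tie_prob_01 mutual_prob_01 in \<open>auto simp: r_def\<close>)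
  show "\<forall>\<^sub>F n in sequentially. measure_pmf.expectation (thinned_binomial_pmf (card (dyads n)) (tie_prob n \<alpha> \<beta>) r) (F n)
     = (\<integral>y. F n (network_counts n y) \<partial>sparse_model n \<alpha> \<beta>)"
    using eventually_ge_at_top[of 1] by eventually_elim (simp add: sparse_model_counts r_def)
qed

lemma sparse_mle_eq_closed_form:
  assumes "is_sparse_mle n ahat bhat" "n \<ge> 1" "y \<in> networks n" "all_dyad_types n (network_counts n y)"
  shows "vector [ahat y, bhat y] = closed_form_mle n (network_counts n y)"
proof -
  obtain t m where tm: "network_counts n y = (t, m)" by force
  with assms(4) have pos: "0 < m" "m < t" "t < card (dyads n)"
    by (auto simp: all_dyad_types_def)
  note eq = sparse_mle_eq[OF assms(1-3) tm pos]
  have "bhat y = ln (real n * real m / (real (card (dyads n)) - real t)) - 2 * ahat y"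
    using eq(2) by simp
  then show ?thesis
    unfolding tm closed_form_mle_def prod.case Let_def eq(1)[symmetric] by simp
qed

text \<open>
  The iterated integral over two standard normals produced by the nested limit theorem is rewritten
  as an integral against the bivariate normal law.
\<close>

lemma integral_normal_limit:
  fixes f :: "real ^ 2 \<Rightarrow> real"
  assumes f: "continuous_on UNIV f" and bdd: "\<And>x. \<bar>f x\<bar> \<le> B"
  shows "(\<integral>x. \<integral>y. f (limit_matrix \<alpha> \<beta> *v vector [x, y]) \<partial>std_normal_distribution \<partial>std_normal_distribution)
    = (\<integral>x. f x \<partial>multivariate_normal 0 (limit_matrix \<alpha> \<beta> ** transpose (limit_matrix \<alpha> \<beta>)))"
    and "(\<lambda>(x, y). f (limit_matrix \<alpha> \<beta> *v vector [x, y])) \<in> borel_measurable (borel \<Otimes>\<^sub>M borel)"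
    and "prob_space (multivariate_normal 0 (limit_matrix \<alpha> \<beta> ** transpose (limit_matrix \<alpha> \<beta>)))"
proof -
  interpret std: prob_space std_normal_distribution
    by (rule prob_space_normal_density) simp
  interpret pair: pair_prob_space std_normal_distribution std_normal_distribution ..
  let ?h = "\<lambda>(x, y). limit_matrix \<alpha> \<beta> *v vector [x, y]"
  have "?h \<in> borel_measurable (lborel \<Otimes>\<^sub>M lborel)"
    using measurable_compose[OF measurable_vector_2, of "\<lambda>x. limit_matrix \<alpha> \<beta> *v x" borel]
    by (simp add: case_prod_unfold borel_measurable_continuous_onI linear_continuous_on bounded_linear.linear)
  then have h [measurable]: "?h \<in> borel_measurable (borel \<Otimes>\<^sub>M borel)"
    by (simp cong: measurable_cong_sets sets_pair_measure_cong)
  have [measurable]: "f \<in> borel_measurable borel"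
    by (rule borel_measurable_continuous_onI[OF f])
  show meas: "(\<lambda>(x, y). f (limit_matrix \<alpha> \<beta> *v vector [x, y])) \<in> borel_measurable (borel \<Otimes>\<^sub>M borel)"
    using measurable_compose[OF h, of f borel] by (simp add: case_prod_unfold)
  have sets: "sets (std_normal_distribution \<Otimes>\<^sub>M std_normal_distribution) = sets (borel \<Otimes>\<^sub>M borel)"
    by (intro sets_pair_measure_cong) auto
  note mvn = linear_image_std_normal_pair[OF det_limit_matrix[of \<alpha> \<beta>], symmetric]
  have h': "?h \<in> borel_measurable (std_normal_distribution \<Otimes>\<^sub>M std_normal_distribution)"
    unfolding measurable_cong_sets[OF sets refl] by (rule h)
  have meas': "(\<lambda>(x, y). f (limit_matrix \<alpha> \<beta> *v vector [x, y]))
      \<in> borel_measurable (std_normal_distribution \<Otimes>\<^sub>M std_normal_distribution)"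
    unfolding measurable_cong_sets[OF sets refl] by (rule meas)
  show "prob_space (multivariate_normal 0 (limit_matrix \<alpha> \<beta> ** transpose (limit_matrix \<alpha> \<beta>)))"
    unfolding mvn by (rule pair.prob_space_distr[OF h'])
  have "integrable (std_normal_distribution \<Otimes>\<^sub>M std_normal_distribution)
      (\<lambda>(x, y). f (limit_matrix \<alpha> \<beta> *v vector [x, y]))"
    by (rule pair.integrable_const_bound[where B = B]) (use meas' bdd in auto)
  from pair.integral_fst'[OF this]
  show "(\<integral>x. \<integral>y. f (limit_matrix \<alpha> \<beta> *v vector [x, y]) \<partial>std_normal_distribution \<partial>std_normal_distribution)
    = (\<integral>x. f x \<partial>multivariate_normal 0 (limit_matrix \<alpha> \<beta> ** transpose (limit_matrix \<alpha> \<beta>)))"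
    unfolding mvn by (subst integral_distr[OF h']) (simp_all add: case_prod_unfold)
qed

theorem sparse_mle_converges_in_distribution:
  fixes \<alpha> \<beta> :: real and M :: "nat \<Rightarrow> 'a measure" and Y :: "nat \<Rightarrow> 'a \<Rightarrow> network"
    and ahat bhat :: "nat \<Rightarrow> network \<Rightarrow> real"
  assumes M: "\<And>n. n \<ge> 1 \<Longrightarrow> prob_space (M n)"
    and Y: "\<And>n. n \<ge> 1 \<Longrightarrow> Y n \<in> M n \<rightarrow>\<^sub>M count_space (networks n)"
    and distr: "\<And>n. n \<ge> 1 \<Longrightarrow> distr (M n) (count_space (networks n)) (Y n) = sparse_model n \<alpha> \<beta>"
    and mle: "\<And>n. n \<ge> 1 \<Longrightarrow> is_sparse_mle n (ahat n) (bhat n)"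
  shows "converges_in_distribution M
      (\<lambda>n \<omega>. sqrt (real n) *\<^sub>R (vector [ahat n (Y n \<omega>) - \<alpha>, bhat n (Y n \<omega>) - \<beta>] :: real ^ 2))
      (multivariate_normal 0 (limit_matrix \<alpha> \<beta> ** transpose (limit_matrix \<alpha> \<beta>)))"
  unfolding converges_in_distribution_def
proof (intro allI impI)
  fix f :: "real ^ 2 \<Rightarrow> real"
  assume cont: "continuous_on UNIV f" and "bounded (range f)"
  then obtain B where B: "\<And>x. \<bar>f x\<bar> \<le> B"
    by (auto simp: bounded_iff)
  define F where "F n c = f (sqrt (real n) *\<^sub>R (closed_form_mle n c - vector [\<alpha>, \<beta>]))" for n c
  define H where "H n y = f (sqrt (real n) *\<^sub>R vector [ahat n y - \<alpha>, bhat n y - \<beta>])" for n y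
  \<comment> \<open>Estimator and closed form may differ only where \<open>bad\<close> is 1, and there the two test values differ by
      at most \<open>2 * B\<close>.\<close>
  define bad :: "nat \<Rightarrow> nat \<times> nat \<Rightarrow> real" where "bad n c = of_bool (\<not> all_dyad_types n c)" for n c
  let ?I = "\<lambda>g :: nat \<Rightarrow> network \<Rightarrow> real. (\<lambda>n. \<integral>y. g n y \<partial>sparse_model n \<alpha> \<beta>)"
  note normal = integral_normal_limit[OF cont B]
  have limF: "?I (\<lambda>n y. F n (network_counts n y)) \<longlonglongrightarrow>
      (\<integral>x. f x \<partial>multivariate_normal 0 (limit_matrix \<alpha> \<beta> ** transpose (limit_matrix \<alpha> \<beta>)))"
  proof -
    have "?I (\<lambda>n y. F n (network_counts n y)) \<longlonglongrightarrow> (\<integral>x. \<integral>y. (\<lambda>(x, y). f (limit_matrix \<alpha> \<beta> *v vector [x, y])) (x, y)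
        \<partial>std_normal_distribution \<partial>std_normal_distribution)"
    proof (rule sparse_model_continuous_mapping)
      show "\<bar>F n c\<bar> \<le> B" for n c
        by (simp add: F_def B)
      have isCont: "isCont f z" for z
        using cont by (simp add: continuous_on_eq_continuous_at)
      show "(\<lambda>n. F n (t n, m n)) \<longlonglongrightarrow> (\<lambda>(x, y). f (limit_matrix \<alpha> \<beta> *v vector [x, y])) (x, y)"
        if "(\<lambda>n. (real (t n) - real (card (dyads n)) * tie_prob n \<alpha> \<beta>) / sqrt (limit_count \<alpha> \<beta> * real n)) \<longlonglongrightarrow> x"
          "(\<lambda>n. (real (m n) - real (t n) * mutual_prob \<alpha> \<beta>) /
            sqrt (limit_count \<alpha> \<beta> * mutual_prob \<alpha> \<beta> * (1 - mutual_prob \<alpha> \<beta>) * real n)) \<longlonglongrightarrow> y" for t m x y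
        unfolding F_def prod.case by (rule isCont_tendsto_compose[OF isCont closed_form_mle_limit(2)[OF that]])
    qed (rule normal(2))
    then show ?thesis
      using normal(1) by simp
  qed
  have lim_bad: "?I (\<lambda>n y. bad n (network_counts n y)) \<longlonglongrightarrow> 0"
  proof -
    have "?I (\<lambda>n y. bad n (network_counts n y)) \<longlonglongrightarrow> (\<integral>x. \<integral>y. (\<lambda>_. 0) (x, y)
        \<partial>std_normal_distribution \<partial>std_normal_distribution)"
    proof (rule sparse_model_continuous_mapping)
      show "\<bar>bad n c\<bar> \<le> 1" for n c
        by (simp add: bad_def)
      show "(\<lambda>n. bad n (t n, m n)) \<longlonglongrightarrow> 0"
        if "(\<lambda>n. (real (t n) - real (card (dyads n)) * tie_prob n \<alpha> \<beta>) / sqrt (limit_count \<alpha> \<beta> * real n)) \<longlonglongrightarrow> x"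
          "(\<lambda>n. (real (m n) - real (t n) * mutual_prob \<alpha> \<beta>) /
            sqrt (limit_count \<alpha> \<beta> * mutual_prob \<alpha> \<beta> * (1 - mutual_prob \<alpha> \<beta>) * real n)) \<longlonglongrightarrow> y" for t m x y
        using closed_form_mle_limit(1)[OF that]
        by (intro tendsto_eventually) (auto simp: bad_def elim: eventually_mono)
    qed simp
    then show ?thesis by simp
  qed
  have diff: "norm ((\<integral>y. H n y \<partial>sparse_model n \<alpha> \<beta>) - (\<integral>y. F n (network_counts n y) \<partial>sparse_model n \<alpha> \<beta>))
      \<le> 2 * B * (\<integral>y. bad n (network_counts n y) \<partial>sparse_model n \<alpha> \<beta>)" if n: "n \<ge> 1" for n
  proof -
    interpret M: prob_space "M n" by (rule M[OF n])
    interpret sparse: prob_space "sparse_model n \<alpha> \<beta>"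
      unfolding distr[OF n, symmetric] by (rule M.prob_space_distr[OF Y[OF n]])
    have sets: "sets (sparse_model n \<alpha> \<beta>) = Pow (networks n)" and space: "space (sparse_model n \<alpha> \<beta>) = networks n"
      by (simp_all add: sparse_model_def sets_point_measure space_point_measure)
    have meas: "g \<in> borel_measurable (sparse_model n \<alpha> \<beta>)" for g :: "network \<Rightarrow> real"
      by (rule measurableI) (auto simp: sets space)
    have int: "integrable (sparse_model n \<alpha> \<beta>) g" if "\<And>y. \<bar>g y\<bar> \<le> C" for g :: "network \<Rightarrow> real" and C
      by (rule sparse.integrable_const_bound[where B = C]) (use meas that in auto)
    have intH: "integrable (sparse_model n \<alpha> \<beta>) (H n)"
      by (rule int[of _ B]) (simp add: H_def B)
    have intF: "integrable (sparse_model n \<alpha> \<beta>) (\<lambda>y. F n (network_counts n y))"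
      by (rule int[of _ B]) (simp add: F_def B)
    have int_bad: "integrable (sparse_model n \<alpha> \<beta>) (\<lambda>y. bad n (network_counts n y))"
      by (rule int[of _ 1]) (simp add: bad_def)
    have le: "\<bar>H n y - F n (network_counts n y)\<bar> \<le> 2 * B * bad n (network_counts n y)" if y: "y \<in> networks n" for y
    proof (cases "all_dyad_types n (network_counts n y)")
      case True
      have "(vector [ahat n y - \<alpha>, bhat n y - \<beta>] :: real ^ 2) = vector [ahat n y, bhat n y] - vector [\<alpha>, \<beta>]"
        by (simp add: vec_eq_iff forall_2)
      also have "\<dots> = closed_form_mle n (network_counts n y) - vector [\<alpha>, \<beta>]"
        using sparse_mle_eq_closed_form[OF mle[OF n] n y True] by simp
      finally show ?thesis using True by (simp add: H_def F_def bad_def)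
    next
      case False
      have "\<bar>H n y\<bar> \<le> B" "\<bar>F n (network_counts n y)\<bar> \<le> B"
        by (simp_all add: H_def F_def B)
      then show ?thesis using False unfolding bad_def by simp
    qed
    have "norm ((\<integral>y. H n y \<partial>sparse_model n \<alpha> \<beta>) - (\<integral>y. F n (network_counts n y) \<partial>sparse_model n \<alpha> \<beta>))
        = norm (\<integral>y. H n y - F n (network_counts n y) \<partial>sparse_model n \<alpha> \<beta>)"
      by (simp add: intH intF)
    also have "\<dots> \<le> (\<integral>y. \<bar>H n y - F n (network_counts n y)\<bar> \<partial>sparse_model n \<alpha> \<beta>)"
      using integral_abs_bound by simp
    also have "\<dots> \<le> (\<integral>y. 2 * B * bad n (network_counts n y) \<partial>sparse_model n \<alpha> \<beta>)"
      by (rule integral_mono) (use intH intF int_bad le space in auto)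
    finally show ?thesis by simp
  qed
  have "(\<lambda>n. (\<integral>y. H n y \<partial>sparse_model n \<alpha> \<beta>) - (\<integral>y. F n (network_counts n y) \<partial>sparse_model n \<alpha> \<beta>)) \<longlonglongrightarrow> 0"
  proof (rule Lim_null_comparison)
    show "\<forall>\<^sub>F n in sequentially. norm ((\<integral>y. H n y \<partial>sparse_model n \<alpha> \<beta>) - (\<integral>y. F n (network_counts n y) \<partial>sparse_model n \<alpha> \<beta>))
      \<le> 2 * B * (\<integral>y. bad n (network_counts n y) \<partial>sparse_model n \<alpha> \<beta>)"
      using eventually_ge_at_top[of 1] by eventually_elim (rule diff)
    show "(\<lambda>n. 2 * B * (\<integral>y. bad n (network_counts n y) \<partial>sparse_model n \<alpha> \<beta>)) \<longlonglongrightarrow> 0"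
      using tendsto_mult_left[OF lim_bad, of "2 * B"] by simp
  qed
  from Lim_transform[OF limF this]
  have limH: "?I H \<longlonglongrightarrow> (\<integral>x. f x \<partial>multivariate_normal 0 (limit_matrix \<alpha> \<beta> ** transpose (limit_matrix \<alpha> \<beta>)))" .
  have "\<forall>\<^sub>F n in sequentially. (\<integral>y. H n y \<partial>sparse_model n \<alpha> \<beta>) = (\<integral>\<omega>. H n (Y n \<omega>) \<partial>M n)"
    using eventually_ge_at_top[of 1]
    by eventually_elim (simp add: distr[symmetric] integral_distr[OF Y])
  from Lim_transform_eventually[OF limH this]
  show "(\<lambda>n. \<integral>\<omega>. f (sqrt (real n) *\<^sub>R vector [ahat n (Y n \<omega>) - \<alpha>, bhat n (Y n \<omega>) - \<beta>]) \<partial>M n)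
    \<longlonglongrightarrow> (\<integral>x. f x \<partial>multivariate_normal 0 (limit_matrix \<alpha> \<beta> ** transpose (limit_matrix \<alpha> \<beta>)))"
    by (simp add: H_def)
qed

theorem theorem3p2:
  fixes \<alpha>_min \<alpha>_max \<beta>_min \<beta>_max \<alpha>\<^sub>0 \<beta>\<^sub>0 :: real
    and M :: "nat \<Rightarrow> 'a measure"
    and Y :: "nat \<Rightarrow> 'a \<Rightarrow> network"
    and \<alpha>_hat \<beta>_hat :: "nat \<Rightarrow> network \<Rightarrow> real"
  assumes "\<alpha>_min \<le> \<alpha>_max" and "\<beta>_min \<le> \<beta>_max"
    and "\<alpha>\<^sub>0 \<in> {\<alpha>_min..\<alpha>_max}" and "\<beta>\<^sub>0 \<in> {\<beta>_min..\<beta>_max}"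
    and "\<And>n. n \<ge> 1 \<Longrightarrow> prob_space (M n)"
    and "\<And>n. n \<ge> 1 \<Longrightarrow> Y n \<in> M n \<rightarrow>\<^sub>M count_space (networks n)"
    and "\<And>n. n \<ge> 1 \<Longrightarrow> distr (M n) (count_space (networks n)) (Y n) = sparse_model n \<alpha>\<^sub>0 \<beta>\<^sub>0"
    and "\<And>n. n \<ge> 1 \<Longrightarrow> is_sparse_mle n (\<alpha>_hat n) (\<beta>_hat n)"
  shows "rate_consistent (\<lambda>n. sqrt (real n)) M
      (\<lambda>n \<omega>. vector [\<alpha>_hat n (Y n \<omega>), \<beta>_hat n (Y n \<omega>)] :: real ^ 2)
      (vector [\<alpha>\<^sub>0, \<beta>\<^sub>0])
    \<and> converges_in_distribution M
      (\<lambda>n \<omega>. sqrt (real n) *\<^sub>R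
         (vector [\<alpha>_hat n (Y n \<omega>) - \<alpha>\<^sub>0, \<beta>_hat n (Y n \<omega>) - \<beta>\<^sub>0] :: real ^ 2))
      (multivariate_normal 0
         (exp (- \<alpha>\<^sub>0) *\<^sub>R
            vector [vector [1, - 2], vector [- 2, 4 + 2 * exp (- \<alpha>\<^sub>0 - \<beta>\<^sub>0)]]))"
proof -
  let ?X = "\<lambda>n \<omega>. sqrt (real n) *\<^sub>R (vector [\<alpha>_hat n (Y n \<omega>) - \<alpha>\<^sub>0, \<beta>_hat n (Y n \<omega>) - \<beta>\<^sub>0] :: real ^ 2)"
  let ?P = "multivariate_normal 0 (limit_matrix \<alpha>\<^sub>0 \<beta>\<^sub>0 ** transpose (limit_matrix \<alpha>\<^sub>0 \<beta>\<^sub>0))"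
  have conv: "converges_in_distribution M ?X ?P"
    using assms(5-8) by (rule sparse_mle_converges_in_distribution)
  have "bounded_in_prob M ?X"
  proof (rule bounded_in_prob_of_converges_in_distribution[OF conv])
    show "prob_space ?P"
      using integral_normal_limit(3)[of "\<lambda>_. 0" 0] by simp
    show "sets ?P = sets borel"
      by (simp add: multivariate_normal_def)
    show "\<forall>\<^sub>F n in sequentially. prob_space (M n) \<and> ?X n \<in> borel_measurable (M n)"
      using eventually_ge_at_top[of 1]
    proof eventually_elim
      case (elim n)
      show ?case
        using assms(5)[OF elim] measurable_compose[OF assms(6)[OF elim],
            of "\<lambda>y. sqrt (real n) *\<^sub>R (vector [\<alpha>_hat n y - \<alpha>\<^sub>0, \<beta>_hat n y - \<beta>\<^sub>0] :: real ^ 2)" borel]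
        by simp
    qed
  qed
  moreover have "?X n \<omega> = sqrt (real n) *\<^sub>R (vector [\<alpha>_hat n (Y n \<omega>), \<beta>_hat n (Y n \<omega>)] - vector [\<alpha>\<^sub>0, \<beta>\<^sub>0])" for n \<omega>
    by (simp add: vec_eq_iff forall_2)
  ultimately show ?thesis
    using conv unfolding rate_consistent_def limit_matrix_covariance by simp
qed

end
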